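(* Let $d\ge1$ and for each $i=1,\dots,d$ let $\mathfrak{D}_i=D_i\sum_{j\ge0}c^{(i)}_jD_i^j=D_i\mathfrak{L}_i$ with real $c^{(i)}_j$, $c^{(i)}_0\ne0$, where $D_i=\partial/\partial x_i$; let $\{p^{(i)}_n\}_{n\ge0}$ be the univariate basic sequence of $\mathfrak{D}_i$ (polynomials in $x_i$). Let $A=(a_{i,j})$ be a real $d\times d$ matrix with $i$-th column $\mathbf{t}_i$, and $Z=\{z_{\mathbf{k}}=A\mathbf{k}:\mathbf{k}\in\mathbb{N}^d\}$; write $z_{\mathbf{k},j}$ for the $j$-th entry of $z_{\mathbf{k}}$. Let $t_{\mathbf{n}}(\mathbf{x};Z)$ be the delta Gončarov (Abel) polynomials associated with $(\mathfrak{D}_1,\dots,\mathfrak{D}_d)$ and $Z$, and fix $\mathbf{n}\in\mathbb{N}^d$. Let $B$ be the diagonal matrix with $B_{i,i}=x_i-z_{\mathbf{n},i}$, $C$ the matrix with $C_{i,j}=z_{n_i\mathbf{e}_i,j}$, $F$ the diagonal matrix of operators with $F_{i,i}=(\mathfrak{D}_i)'_{x_i}$, and $G$ the matrix of operators with $G_{i,j}=a_{i,j}\mathfrak{D}_i$. Then: (i) $t_{\mathbf{n}}(\mathbf{x};Z)=\det(B+C)\prod_{i=1}^d\dfrac{p^{(i)}_{n_i}(x_i-z_{\mathbf{n},i})}{x_i-z_{\mathbf{n},i}}$ (as an identity of rational functions); (ii) with $\mathfrak{S}_i=\mathfrak{D}_i\mathfrak{E}_{\mathbf{t}_i}$, $t_{\mathbf{n}}(\mathbf{x};Z)=\det\big((\mathfrak{S}_i)'_{x_j}\big)_{i,j=1}^d\Big(\prod_{i=1}^d\mathfrak{L}_i^{-n_i-1}\Big)\Big(\prod_{i=1}^d\mathfrak{E}_{\mathbf{t}_i}^{-n_i-1}\Big)\mathbf{x}^{\mathbf{n}}$;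 (iii) $t_{\mathbf{n}}(\mathbf{x};Z)=\det(F+G)\Big(\prod_{i=1}^d\mathfrak{L}_i^{-n_i-1}\Big)\Big(\prod_{i=1}^d\mathfrak{E}_{\mathbf{t}_i}^{-n_i}\Big)\mathbf{x}^{\mathbf{n}}$.
   Context: $\mathfrak{E}_{\mathbf{v}}$ is the shift $f(\mathbf{x})\mapsto f(\mathbf{x}+\mathbf{v})$ on $\mathbb{R}[x_1,\dots,x_d]$; shift-invariant operators commute with all shifts, are exactly the formal power series in $D_1,\dots,D_d$, and commute with each other, so determinants of matrices of such operators are well defined. The univariate basic sequence $\{p^{(i)}_n\}$ of $\mathfrak{D}_i$ satisfies $\deg p^{(i)}_n=n$, $p^{(i)}_0=1$, $p^{(i)}_n(0)=0$ for $n\ge1$, $\mathfrak{D}_ip^{(i)}_n=np^{(i)}_{n-1}$; the basic sequence of the system is $\{p_{\mathbf{n}}=\prod_ip^{(i)}_{n_i}(x_i)\}$, and $\Pi^d_{\mathbf{n}}=\operatorname{span}\{p_{\mathbf{k}}:\mathbf{k}\le\mathbf{n}\}$ (componentwise order). The delta Gončarov polynomial $t_{\mathbf{n}}(\mathbf{x};Z)$ is the unique polynomial in $\Pi^d_{\mathbf{n}}$ with $\big[\mathfrak{D}_1^{k_1}\cdots\mathfrak{D}_d^{k_d}t_{\mathbf{n}}\big](z_{\mathbf{k}})=\mathbf{n}!\,\delta_{\mathbf{k},\mathbf{n}}$ for all $\mathbf{k}\le\mathbf{n}$. For a shift-invariant operator $\mathfrak{L}$, the Pincherle derivative with respect to $x_j$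 is $\mathfrak{L}'_{x_j}(p)=\mathfrak{L}(x_jp)-x_j\mathfrak{L}(p)$. $\mathbf{e}_i$ is the $i$-th standard basis vector and $\mathbf{x}^{\mathbf{n}}=\prod_ix_i^{n_i}$. *)

theory Defs
  imports
    "HOL-Analysis.Analysis"
    "HOL-Library.Groups_Big_Fun"
    "HOL-Computational_Algebra.Polynomial"
    "HOL-Computational_Algebra.Fraction_Field"
begin

section \<open>The polynomial ring\<close>

text \<open>
  Over the reals a polynomial is the same thing as a polynomial function, so the ring of
  real polynomials in the variables indexed by \<open>'d\<close> is realised by the library's
  polynomial functions on \<open>real ^ 'd\<close>. It is shown below to be an integral domain, so that its
  fraction field (the field of rational functions) is available as \<open>'d rpoly fract\<close>.
\<close>

typedef (overloaded) ('d::finite) rpoly = "{f :: real ^ 'd \<Rightarrow> real. real_polynomial_function f}"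
  morphisms ev Abs_rpoly
  by (rule exI[of _ "\<lambda>x. 0"]) auto

setup_lifting type_definition_rpoly

lemma rpoly_eqI: "(\<And>x. ev p x = ev q x) \<Longrightarrow> p = q"
  by (metis ev_inject ext)

instantiation rpoly :: (finite) comm_ring_1
begin

lift_definition zero_rpoly :: "'a rpoly" is "\<lambda>x. 0" by auto
lift_definition one_rpoly :: "'a rpoly" is "\<lambda>x. 1" by auto
lift_definition plus_rpoly :: "'a rpoly \<Rightarrow> 'a rpoly \<Rightarrow> 'a rpoly" is "\<lambda>f g x. f x + g x" by auto
lift_definition minus_rpoly :: "'a rpoly \<Rightarrow> 'a rpoly \<Rightarrow> 'a rpoly" is "\<lambda>f g x. f x - g x" by auto
lift_definition uminus_rpoly :: "'a rpoly \<Rightarrow> 'a rpoly" is "\<lambda>f x. - f x" by auto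
lift_definition times_rpoly :: "'a rpoly \<Rightarrow> 'a rpoly \<Rightarrow> 'a rpoly" is "\<lambda>f g x. f x * g x" by auto

instance
  by standard (transfer; auto simp: algebra_simps fun_eq_iff)+

end

instantiation rpoly :: (finite) real_algebra_1
begin

lift_definition scaleR_rpoly :: "real \<Rightarrow> 'a rpoly \<Rightarrow> 'a rpoly" is "\<lambda>c f x. c * f x" by auto

instance
  by standard (transfer; auto simp: algebra_simps fun_eq_iff)+

end

lemma ev_simps [simp]:
  "ev 0 x = 0" "ev 1 x = 1" "ev (p + q) x = ev p x + ev q x" "ev (p - q) x = ev p x - ev q x"
  "ev (- p) x = - ev p x" "ev (p * q) x = ev p x * ev q x" "ev (c *\<^sub>R p) x = c * ev p x"
  by (transfer; simp)+

lemma ev_of_real [simp]: "ev (of_real c) x = c"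
  by (simp add: of_real_def)

lemma ev_sum [simp]: "ev (sum f I) x = (\<Sum>i\<in>I. ev (f i) x)"
  by (induction I rule: infinite_finite_induct) auto

lemma poly_fun_line_zero:
  fixes a b :: "real ^ 'd::finite"
  assumes "real_polynomial_function f" "f a \<noteq> 0"
  shows "finite {t. f (a + t *\<^sub>R b) = 0}"
proof -
  have "polynomial_function (\<lambda>t::real. a + t *\<^sub>R b)"
    by (intro polynomial_function_add polynomial_function_const polynomial_function_mult
        polynomial_function_id)
  hence "real_polynomial_function (f \<circ> (\<lambda>t. a + t *\<^sub>R b))"
    using assms(1) by blast
  then obtain c m where c: "f \<circ> (\<lambda>t. a + t *\<^sub>R b) = (\<lambda>t. \<Sum>i\<le>m. c i * t ^ i)"
    using real_polynomial_function_iff_sum by blast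
  have "\<exists>i\<le>m. c i \<noteq> 0"
  proof (rule ccontr)
    assume "\<not> ?thesis"
    hence "(f \<circ> (\<lambda>t. a + t *\<^sub>R b)) 0 = 0"
      unfolding c by (intro sum.neutral) auto
    with assms(2) show False by simp
  qed
  then obtain i where i: "i \<le> m" "c i \<noteq> 0" by blast
  have "finite {t. (\<Sum>i\<le>m. c i * t ^ i) = 0}"
    using polyfun_finite_roots[of c m] i by auto
  moreover have "f (a + t *\<^sub>R b) = (\<Sum>i\<le>m. c i * t ^ i)" for t
    using fun_cong[OF c, of t] by simp
  ultimately show ?thesis by simp
qed

instance rpoly :: (finite) idom
proof
  fix p q :: "'a rpoly"
  assume "p \<noteq> 0" "q \<noteq> 0"
  then obtain a b where a: "ev p a \<noteq> 0" and b: "ev q b \<noteq> 0"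
    using rpoly_eqI[of p 0] rpoly_eqI[of q 0] by auto
  have "finite {t. ev p (a + t *\<^sub>R (b - a)) = 0}"
    by (rule poly_fun_line_zero) (use ev[of p] a in auto)
  moreover have "finite {t. ev q (b + t *\<^sub>R (a - b)) = 0}"
    by (rule poly_fun_line_zero) (use ev[of q] b in auto)
  hence "finite ((\<lambda>t. 1 - t) ` {t. ev q (b + t *\<^sub>R (a - b)) = 0})" by blast
  ultimately have "finite ({t. ev p (a + t *\<^sub>R (b - a)) = 0} \<union>
      (\<lambda>t. 1 - t) ` {t. ev q (b + t *\<^sub>R (a - b)) = 0})" by blast
  then obtain t where t: "t \<notin> {t. ev p (a + t *\<^sub>R (b - a)) = 0} \<union>
      (\<lambda>t. 1 - t) ` {t. ev q (b + t *\<^sub>R (a - b)) = 0}"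
    using ex_new_if_finite[OF infinite_UNIV_char_0] by blast
  let ?x = "a + t *\<^sub>R (b - a)"
  have "?x = b + (1 - t) *\<^sub>R (a - b)" by (simp add: algebra_simps)
  moreover have "ev q (b + (1 - t) *\<^sub>R (a - b)) \<noteq> 0"
  proof
    assume "ev q (b + (1 - t) *\<^sub>R (a - b)) = 0"
    hence "1 - (1 - t) \<in> (\<lambda>t. 1 - t) ` {t. ev q (b + t *\<^sub>R (a - b)) = 0}" by blast
    with t show False by simp
  qed
  ultimately have "ev (p * q) ?x \<noteq> ev 0 ?x" using t by auto
  thus "p * q \<noteq> 0" by (rule contrapos_nn) (rule arg_cong)
qed

lift_definition X :: "'d::finite \<Rightarrow> 'd rpoly" is "\<lambda>i x. x $ i"
  by (rule real_polynomial_function.intros(1)) (rule bounded_linear_vec_nth)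

lemma ev_X [simp]: "ev (X i) x = x $ i"
  by transfer simp

lemma rpoly_induct [case_names const X add mult]:
  fixes p :: "'d::finite rpoly"
  assumes const: "\<And>c. P (of_real c)" and X: "\<And>i. P (X i)"
    and add: "\<And>p q. P p \<Longrightarrow> P q \<Longrightarrow> P (p + q)" and mult: "\<And>p q. P p \<Longrightarrow> P q \<Longrightarrow> P (p * q)"
  shows "P p"
proof -
  have "\<exists>q. P q \<and> ev q = f" if "real_polynomial_function f" for f :: "real ^ 'd \<Rightarrow> real"
    using that
  proof induction
    case (linear f)
    interpret bounded_linear f by fact
    have "P (\<Sum>i\<in>I. of_real (f (axis i 1)) * X i)" if "finite I" for I :: "'d set"
      using that by (induction I) (auto intro: assms(1)[of 0, simplified] assms)
    hence "P (\<Sum>i\<in>UNIV. of_real (f (axis i 1)) * X i)" by simp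
    moreover have "ev (\<Sum>i\<in>UNIV. of_real (f (axis i 1)) * X i) x = f x" for x
    proof -
      have "f x = f (\<Sum>i\<in>UNIV. x $ i *\<^sub>R axis i 1)"
        by (simp add: basis_expansion[where 'a=real, unfolded scalar_mult_eq_scaleR])
      thus ?thesis by (simp add: sum scaleR mult.commute)
    qed
    ultimately show ?case by blast
  next
    case (const c)
    show ?case by (rule exI[of _ "of_real c"]) (auto simp: assms)
  next
    case (add f g)
    then obtain q r where "P q" "ev q = f" "P r" "ev r = g" by blast
    thus ?case by (intro exI[of _ "q + r"]) (auto simp: assms)
  next
    case (mult f g)
    then obtain q r where "P q" "ev q = f" "P r" "ev r = g" by blast
    thus ?case by (intro exI[of _ "q * r"]) (auto simp: assms)
  qed
  from this[of "ev p"] show ?thesis using ev[of p] by (auto simp: ev_inject)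
qed

text \<open>Substitution of \<open>f\<close> for the variable of the univariate polynomial \<open>q\<close>.\<close>

definition psubst :: "real poly \<Rightarrow> 'd::finite rpoly \<Rightarrow> 'd rpoly" where
  "psubst q f = poly (map_poly of_real q) f"

lemma ev_psubst: "ev (psubst q f) x = poly q (ev f x)"
  by (induction q) (auto simp: psubst_def map_poly_pCons)


section \<open>Shifts and partial derivatives\<close>

lift_definition shift :: "real ^ 'd::finite \<Rightarrow> 'd rpoly \<Rightarrow> 'd rpoly" is "\<lambda>v f x. f (x + v)"
proof -
  fix v :: "real ^ 'd" and f :: "real ^ 'd \<Rightarrow> real"
  assume "real_polynomial_function f"
  moreover have "polynomial_function (\<lambda>x::real ^ 'd. x + v)"
    by (intro polynomial_function_add polynomial_function_const polynomial_function_id)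
  ultimately have "real_polynomial_function (f \<circ> (\<lambda>x. x + v))" by blast
  thus "real_polynomial_function (\<lambda>x. f (x + v))" by (simp add: o_def)
qed

lemma ev_shift [simp]: "ev (shift v p) x = ev p (x + v)"
  by transfer simp

lemma shift_simps [simp]:
  "shift v (p + q) = shift v p + shift v q" "shift v (p * q) = shift v p * shift v q"
  "shift v (p - q) = shift v p - shift v q" "shift v (c *\<^sub>R p) = c *\<^sub>R shift v p"
  "shift v (of_real c) = of_real c" "shift v 0 = 0" "shift v 1 = 1" "shift v (X i) = X i + of_real (v $ i)"
  by (rule rpoly_eqI; simp)+

lemma shift_shift: "shift v (shift w p) = shift (v + w) p"
  by (rule rpoly_eqI) (simp add: add_ac)

lemma linear_shift: "linear (shift v)"
  by (rule linearI) auto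

lemma poly_fun_has_partial:
  fixes i :: "'d::finite"
  shows "\<exists>q. \<forall>x. ((\<lambda>h. ev p (x + h *\<^sub>R axis i 1)) has_real_derivative ev q x) (at 0)"
proof (induction p rule: rpoly_induct)
  case (const c)
  show ?case by (rule exI[of _ 0]) auto
next
  case (X j)
  show ?case
  proof (rule exI[of _ "of_real (axis i 1 $ j)"], intro allI)
    fix x :: "real ^ 'd"
    show "((\<lambda>h. ev (X j) (x + h *\<^sub>R axis i 1)) has_real_derivative
        ev (of_real (axis i 1 $ j)) x) (at 0)"
      by (auto intro!: derivative_eq_intros)
  qed
next
  case (add p q)
  then obtain p' q' where *:
    "\<And>x. ((\<lambda>h. ev p (x + h *\<^sub>R axis i 1)) has_real_derivative ev p' x) (at 0)"
    "\<And>x. ((\<lambda>h. ev q (x + h *\<^sub>R axis i 1)) has_real_derivative ev q' x) (at 0)"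
    by blast
  show ?case
    by (rule exI[of _ "p' + q'"]) (auto intro!: derivative_eq_intros *)
next
  case (mult p q)
  then obtain p' q' where *:
    "\<And>x. ((\<lambda>h. ev p (x + h *\<^sub>R axis i 1)) has_real_derivative ev p' x) (at 0)"
    "\<And>x. ((\<lambda>h. ev q (x + h *\<^sub>R axis i 1)) has_real_derivative ev q' x) (at 0)"
    by blast
  show ?case
    by (rule exI[of _ "p' * q + p * q'"])
      (auto intro!: derivative_eq_intros *)
qed

lift_definition partial :: "'d::finite \<Rightarrow> 'd rpoly \<Rightarrow> 'd rpoly"
  is "\<lambda>i f x. deriv (\<lambda>h. f (x + h *\<^sub>R axis i 1)) 0"
proof -
  fix i :: 'd and f :: "real ^ 'd \<Rightarrow> real"
  assume f: "real_polynomial_function f"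
  obtain q where "\<forall>x. ((\<lambda>h. ev (Abs_rpoly f) (x + h *\<^sub>R axis i 1)) has_real_derivative ev q x) (at 0)"
    using poly_fun_has_partial by blast
  hence "(\<lambda>x. deriv (\<lambda>h. f (x + h *\<^sub>R axis i 1)) 0) = ev q"
    using f by (auto simp: Abs_rpoly_inverse intro!: DERIV_imp_deriv)
  thus "real_polynomial_function (\<lambda>x. deriv (\<lambda>h. f (x + h *\<^sub>R axis i 1)) 0)"
    using ev[of q] by simp
qed

lemma has_partial: "((\<lambda>h. ev p (x + h *\<^sub>R axis i 1)) has_real_derivative ev (partial i p) x) (at 0)"
proof -
  obtain q where "((\<lambda>h. ev p (x + h *\<^sub>R axis i 1)) has_real_derivative ev q x) (at 0)"
    using poly_fun_has_partial by blast
  moreover have "ev (partial i p) x = deriv (\<lambda>h. ev p (x + h *\<^sub>R axis i 1)) 0"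
    by transfer simp
  ultimately show ?thesis by (metis DERIV_imp_deriv)
qed

lemma partialI:
  assumes "\<And>x. ((\<lambda>h. ev p (x + h *\<^sub>R axis i 1)) has_real_derivative ev q x) (at 0)"
  shows "partial i p = q"
  by (rule rpoly_eqI) (rule DERIV_unique[OF has_partial assms])

lemma partial_simps [simp]:
  "partial i (p + q) = partial i p + partial i q"
  "partial i (p * q) = partial i p * q + p * partial i q"
  "partial i (c *\<^sub>R p) = c *\<^sub>R partial i p"
  "partial i (of_real c) = 0" "partial i 0 = 0"
  "partial i (X j) = of_real (axis i 1 $ j)"
  by (rule partialI; auto intro!: derivative_eq_intros has_partial)+

lemma partial_shift: "partial i (shift v p) = shift v (partial i p)"
proof (rule partialI)
  fix x
  show "((\<lambda>h. ev (shift v p) (x + h *\<^sub>R axis i 1)) has_real_derivative ev (shift v (partial i p)) x) (at 0)"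
    using has_partial[of p "x + v" i] by (simp add: add_ac)
qed

lemma linear_partial_funpow: "linear (partial i ^^ k)"
  by (induction k) (auto intro!: linearI simp: linear_add linear_scale)

lemma partial_funpow_add: "(partial i ^^ k) (p + q) = (partial i ^^ k) p + (partial i ^^ k) q"
  using linear_add[OF linear_partial_funpow] .

lemma partial_funpow_0 [simp]: "(partial i ^^ k) 0 = 0"
  by (induction k) auto

lemma partial_funpow_shift: "(partial i ^^ k) (shift v p) = shift v ((partial i ^^ k) p)"
  by (induction k) (auto simp: partial_shift)

lemma partial_nilpotent_mono:
  assumes "(partial i ^^ k) p = 0" "k \<le> m"
  shows "(partial i ^^ m) p = 0"
proof -
  have "(partial i ^^ m) p = (partial i ^^ (m - k)) ((partial i ^^ k) p)"
    using assms(2) by (simp flip: funpow_add[THEN fun_cong, unfolded o_def])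
  thus ?thesis using assms(1) by simp
qed

lemma partial_nilpotent_mult:
  "(partial i ^^ k) p = 0 \<Longrightarrow> (partial i ^^ m) q = 0 \<Longrightarrow> (partial i ^^ (k + m)) (p * q) = 0"
proof (induction "k + m" arbitrary: k m p q)
  case 0
  thus ?case by simp
next
  case (Suc s)
  show ?case
  proof (cases "k = 0 \<or> m = 0")
    case True
    with Suc.prems have "p * q = 0" by auto
    thus ?thesis by (simp only: partial_funpow_0)
  next
    case False
    then obtain k' m' where km: "k = Suc k'" "m = Suc m'" by (metis not0_implies_Suc)
    have 1: "(partial i ^^ (k' + m)) (partial i p * q) = 0"
      by (rule Suc.hyps(1)) (use Suc.prems Suc.hyps(2) km in \<open>auto simp: funpow_Suc_right simp del: funpow.simps\<close>)
    have 2: "(partial i ^^ (k + m')) (p * partial i q) = 0"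
      by (rule Suc.hyps(1)) (use Suc.prems Suc.hyps(2) km in \<open>auto simp: funpow_Suc_right simp del: funpow.simps\<close>)
    have *: "k + m = Suc (k' + m)" "k' + m = k + m'" using km by auto
    have "(partial i ^^ (k + m)) (p * q) = (partial i ^^ (k' + m)) (partial i (p * q))"
      by (simp only: *(1) funpow_Suc_right o_apply)
    also have "\<dots> = 0"
      using 1 2 by (simp only: *(2) partial_simps partial_funpow_add add_0_left)
    finally show ?thesis .
  qed
qed

lemma partial_nilpotent: "\<exists>k. (partial i ^^ k) p = 0"
proof (induction p rule: rpoly_induct)
  case (const c)
  show ?case by (rule exI[of _ 1]) simp
next
  case (X j)
  show ?case by (rule exI[of _ 2]) (simp add: numeral_2_eq_2)
next
  case (add p q)
  then obtain k m where "(partial i ^^ k) p = 0" "(partial i ^^ m) q = 0" by blast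
  hence "(partial i ^^ max k m) p = 0" "(partial i ^^ max k m) q = 0"
    using partial_nilpotent_mono[of k i p "max k m"] partial_nilpotent_mono[of m i q "max k m"] by simp_all
  thus ?case by (intro exI[of _ "max k m"]) (simp add: partial_funpow_add)
next
  case (mult p q)
  thus ?case using partial_nilpotent_mult by blast
qed

lemma finite_partial_support: "finite {j. c j *\<^sub>R (partial i ^^ j) p \<noteq> 0}"
proof -
  obtain k where k: "(partial i ^^ k) p = 0" using partial_nilpotent by blast
  have "{j. c j *\<^sub>R (partial i ^^ j) p \<noteq> 0} \<subseteq> {..<k}"
    using partial_nilpotent_mono[OF k] by (auto simp: not_le[symmetric])
  thus ?thesis by (rule finite_subset) simp
qed


section \<open>The ring of shift-invariant operators\<close>

typedef (overloaded) ('d::finite) sio =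
    "{L :: 'd rpoly \<Rightarrow> 'd rpoly. linear L \<and> (\<forall>v p. L (shift v p) = shift v (L p))}"
  morphisms app Abs_sio
  by (rule exI[of _ "\<lambda>p. p"]) (auto intro: linear_id[unfolded id_def])

setup_lifting type_definition_sio

lemma linear_app: "linear (app L)"
  and app_shift: "app L (shift v p) = shift v (app L p)"
  using app[of L] by auto

lemma sio_eqI: "(\<And>p. app S p = app T p) \<Longrightarrow> S = T"
  by (metis app_inject ext)

lemma shift_decomposition:
  "\<exists>ps :: ('d::finite rpoly \<times> 'd rpoly) list. \<forall>x y. ev p (x + y) = (\<Sum>(a, b)\<leftarrow>ps. ev a x * ev b y)"
proof (induction p rule: rpoly_induct)
  case (const c)
  show ?case by (rule exI[of _ "[(of_real c, 1)]"]) simp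
next
  case (X i)
  show ?case by (rule exI[of _ "[(X i, 1), (1, X i)]"]) simp
next
  case (add p q)
  then obtain ps qs :: "('d rpoly \<times> 'd rpoly) list"
    where "\<forall>x y. ev p (x + y) = (\<Sum>(a, b)\<leftarrow>ps. ev a x * ev b y)"
      "\<forall>x y. ev q (x + y) = (\<Sum>(a, b)\<leftarrow>qs. ev a x * ev b y)" by blast
  thus ?case by (intro exI[of _ "ps @ qs"]) simp
next
  case (mult p q)
  then obtain ps qs :: "('d rpoly \<times> 'd rpoly) list"
    where *: "\<forall>x y. ev p (x + y) = (\<Sum>(a, b)\<leftarrow>ps. ev a x * ev b y)"
      "\<forall>x y. ev q (x + y) = (\<Sum>(a, b)\<leftarrow>qs. ev a x * ev b y)" by blast
  have 1: "sum_list (map ((\<lambda>(a, b). ev a x * ev b y) \<circ> (\<lambda>(c, d). (a * c, b * d))) qs) =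
      ev a x * ev b y * (\<Sum>(a, b)\<leftarrow>qs. ev a x * ev b y)" for a b x y
    by (induction qs) (auto simp: algebra_simps)
  have "(\<Sum>(a, b)\<leftarrow>concat (map (\<lambda>(a, b). map (\<lambda>(c, d). (a * c, b * d)) qs) ps). ev a x * ev b y) =
      (\<Sum>(a, b)\<leftarrow>ps. ev a x * ev b y) * (\<Sum>(a, b)\<leftarrow>qs. ev a x * ev b y)" for x y
    by (induction ps) (auto simp: 1 distrib_right simp del: mult_cancel_left mult_cancel_right)
  with * show ?case
    by (intro exI[of _ "concat (map (\<lambda>(a, b). map (\<lambda>(c, d). (a * c, b * d)) qs) ps)"]) simp
qed

lemma linear_sum_list:
  "linear L \<Longrightarrow> L (\<Sum>(a, b)\<leftarrow>ps. f a b *\<^sub>R g a b) = (\<Sum>(a, b)\<leftarrow>ps. f a b *\<^sub>R L (g a b))"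
  by (induction ps) (auto simp: linear_0 linear_add linear_scale)

lemma ev_sum_list: "ev (\<Sum>(a, b)\<leftarrow>ps. f a b *\<^sub>R g a b) x = (\<Sum>(a, b)\<leftarrow>ps. f a b * ev (g a b) x)"
  by (induction ps) auto

lemma sio_commute: "app S (app T p) = app T (app S p)"
proof -
  have expand: "app L p = (\<Sum>(a, b)\<leftarrow>ps. ev (app L b) 0 *\<^sub>R a)"
    if "\<forall>x y. ev p (x + y) = (\<Sum>(a, b)\<leftarrow>ps. ev a x * ev b y)" for L :: "'a sio" and p ps
  proof (rule rpoly_eqI)
    fix x
    have *: "shift x p = (\<Sum>(a, b)\<leftarrow>ps. ev a x *\<^sub>R b)"
      by (rule rpoly_eqI) (simp add: ev_sum_list that add.commute[of _ x])
    have "ev (app L p) x = ev (app L (shift x p)) 0"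
      by (simp add: app_shift)
    also have "\<dots> = (\<Sum>(a, b)\<leftarrow>ps. ev a x * ev (app L b) 0)"
      by (simp add: * linear_sum_list[OF linear_app] ev_sum_list)
    finally show "ev (app L p) x = ev (\<Sum>(a, b)\<leftarrow>ps. ev (app L b) 0 *\<^sub>R a) x"
      by (simp add: ev_sum_list mult.commute)
  qed
  have at_0: "ev (app S (app T p)) 0 = ev (app T (app S p)) 0" for p
  proof -
    obtain ps where ps: "\<forall>x y. ev p (x + y) = (\<Sum>(a, b)\<leftarrow>ps. ev a x * ev b y)"
      using shift_decomposition by blast
    define qs where "qs = map (\<lambda>(a, b). (b, a)) ps"
    have "(\<Sum>(a, b)\<leftarrow>qs. f a b) = (\<Sum>(a, b)\<leftarrow>ps. f b a)" for f :: "_ \<Rightarrow> _ \<Rightarrow> real"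
      by (simp add: qs_def case_prod_unfold o_def)
    hence "(\<Sum>(a, b)\<leftarrow>qs. ev a x * ev b y) = ev p (x + y)" for x y
      using ps[rule_format, of y x] by (simp add: mult.commute add.commute)
    hence qs: "\<forall>x y. ev p (x + y) = (\<Sum>(a, b)\<leftarrow>qs. ev a x * ev b y)" by simp
    have "ev (app S (app T p)) 0 = (\<Sum>(a, b)\<leftarrow>ps. ev (app T b) 0 * ev (app S a) 0)"
      by (simp add: expand[OF ps, of T] linear_sum_list[OF linear_app] ev_sum_list)
    also have "\<dots> = (\<Sum>(a, b)\<leftarrow>qs. ev (app S b) 0 * ev (app T a) 0)"
      by (simp add: qs_def case_prod_unfold o_def mult.commute)
    also have "\<dots> = ev (app T (app S p)) 0"
      by (simp add: expand[OF qs, of S] linear_sum_list[OF linear_app] ev_sum_list)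
    finally show ?thesis .
  qed
  show ?thesis
  proof (rule rpoly_eqI)
    fix x
    show "ev (app S (app T p)) x = ev (app T (app S p)) x"
      using at_0[of "shift x p"] by (simp add: app_shift)
  qed
qed

instantiation sio :: (finite) "{zero, one, plus, minus, uminus, times}"
begin

lift_definition zero_sio :: "'a sio" is "\<lambda>p. 0"
  by (auto intro!: linearI)
lift_definition one_sio :: "'a sio" is "\<lambda>p. p"
  by (auto intro!: linearI)
lift_definition plus_sio :: "'a sio \<Rightarrow> 'a sio \<Rightarrow> 'a sio" is "\<lambda>S T p. S p + T p"
  by (auto intro: linear_compose_add)
lift_definition minus_sio :: "'a sio \<Rightarrow> 'a sio \<Rightarrow> 'a sio" is "\<lambda>S T p. S p - T p"
  by (auto intro: linear_compose_sub)
lift_definition uminus_sio :: "'a sio \<Rightarrow> 'a sio" is "\<lambda>S p. - S p"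
  by (auto intro!: linear_compose_neg rpoly_eqI)
lift_definition times_sio :: "'a sio \<Rightarrow> 'a sio \<Rightarrow> 'a sio" is "\<lambda>S T p. S (T p)"
  by (auto intro: linear_compose[unfolded o_def])

instance ..

end

instantiation sio :: (finite) scaleR
begin

lift_definition scaleR_sio :: "real \<Rightarrow> 'a sio \<Rightarrow> 'a sio" is "\<lambda>c S p. c *\<^sub>R S p"
  by (auto intro: linear_compose_scale_right)

instance ..

end

lemma app_simps [simp]:
  "app 0 p = 0" "app 1 p = p" "app (S + T) p = app S p + app T p" "app (S - T) p = app S p - app T p"
  "app (- S) p = - app S p" "app (S * T) p = app S (app T p)" "app (c *\<^sub>R S) p = c *\<^sub>R app S p"
  by (transfer; simp)+

lemma app_arg_simps [simp]:
  "app S 0 = 0" "app S (p + q) = app S p + app S q" "app S (c *\<^sub>R p) = c *\<^sub>R app S p"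
  using linear_app[of S] by (auto simp: linear_0 linear_add linear_scale)

instance sio :: (finite) comm_ring_1
proof
  fix R S T :: "'a sio"
  show "R * S * T = R * (S * T)" by (rule sio_eqI) simp
  show "S * T = T * S" by (rule sio_eqI) (simp add: sio_commute)
  show "1 * S = S" by (rule sio_eqI) simp
  show "R + S + T = R + (S + T)" by (rule sio_eqI) (simp add: add.assoc)
  show "S + T = T + S" by (rule sio_eqI) (simp add: add.commute)
  show "0 + S = S" by (rule sio_eqI) simp
  show "- S + S = 0" by (rule sio_eqI) simp
  show "S - T = S + - T" by (rule sio_eqI) simp
  show "(R + S) * T = R * T + S * T" by (rule sio_eqI) simp
  have "app 0 1 \<noteq> app (1 :: 'a sio) 1" by simp
  thus "(0 :: 'a sio) \<noteq> 1" by (rule contrapos_nn) simp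
qed

instance sio :: (finite) real_algebra_1
proof
  fix a b :: real and S T :: "'a sio"
  show "a *\<^sub>R (S + T) = a *\<^sub>R S + a *\<^sub>R T" by (rule sio_eqI) (simp add: scaleR_add_right)
  show "(a + b) *\<^sub>R S = a *\<^sub>R S + b *\<^sub>R S" by (rule sio_eqI) (simp add: scaleR_add_left)
  show "a *\<^sub>R b *\<^sub>R S = (a * b) *\<^sub>R S" by (rule sio_eqI) simp
  show "1 *\<^sub>R S = S" by (rule sio_eqI) simp
  show "a *\<^sub>R S * T = a *\<^sub>R (S * T)" by (rule sio_eqI) simp
  show "S * a *\<^sub>R T = a *\<^sub>R (S * T)" by (rule sio_eqI) simp
qed

lift_definition shift_op :: "real ^ 'd::finite \<Rightarrow> 'd sio" is shift
  by (auto simp: linear_shift shift_shift add.commute)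

lift_definition diff_op :: "'d::finite \<Rightarrow> 'd sio" is partial
  by (auto intro!: linearI simp: partial_shift)

text \<open>
  The operator \<open>\<Sum>\<^sub>j c\<^sub>j D\<^sub>i\<^sup>j\<close>. On every polynomial only finitely many
  terms are nonzero (\<open>finite_partial_support\<close>), so \<^const>\<open>Sum_any\<close> is the actual sum.
\<close>

lift_definition series_op :: "'d::finite \<Rightarrow> (nat \<Rightarrow> real) \<Rightarrow> 'd sio"
  is "\<lambda>i c p. Sum_any (\<lambda>j. c j *\<^sub>R (partial i ^^ j) p)"
proof (intro conjI allI)
  fix i :: 'd and c :: "nat \<Rightarrow> real"
  have expand: "Sum_any (\<lambda>j. c j *\<^sub>R (partial i ^^ j) p) = (\<Sum>j<k. c j *\<^sub>R (partial i ^^ j) p)"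
    if "(partial i ^^ k) p = 0" for p k
  proof (rule Sum_any.expand_superset)
    show "{j. c j *\<^sub>R (partial i ^^ j) p \<noteq> 0} \<subseteq> {..<k}"
      using partial_nilpotent_mono[OF that] by (auto simp: not_le[symmetric])
  qed simp
  show "linear (\<lambda>p. Sum_any (\<lambda>j. c j *\<^sub>R (partial i ^^ j) p))"
  proof (rule linearI)
    fix p q
    show "Sum_any (\<lambda>j. c j *\<^sub>R (partial i ^^ j) (p + q)) =
        Sum_any (\<lambda>j. c j *\<^sub>R (partial i ^^ j) p) + Sum_any (\<lambda>j. c j *\<^sub>R (partial i ^^ j) q)"
      by (simp add: partial_funpow_add scaleR_add_right Sum_any.distrib finite_partial_support
          del: scaleR_eq_0_iff)
  next
    fix r p
    obtain k where k: "(partial i ^^ k) p = 0" using partial_nilpotent by blast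
    hence "(partial i ^^ k) (r *\<^sub>R p) = 0"
      by (simp add: linear_scale[OF linear_partial_funpow])
    from expand[OF k] expand[OF this]
    show "Sum_any (\<lambda>j. c j *\<^sub>R (partial i ^^ j) (r *\<^sub>R p)) = r *\<^sub>R Sum_any (\<lambda>j. c j *\<^sub>R (partial i ^^ j) p)"
      by (simp add: linear_scale[OF linear_partial_funpow] scaleR_sum_right mult.commute)
  qed
  fix v p
  obtain k where k: "(partial i ^^ k) p = 0" using partial_nilpotent by blast
  hence "(partial i ^^ k) (shift v p) = 0"
    by (simp add: partial_funpow_shift)
  from expand[OF k] expand[OF this]
  show "Sum_any (\<lambda>j. c j *\<^sub>R (partial i ^^ j) (shift v p)) = shift v (Sum_any (\<lambda>j. c j *\<^sub>R (partial i ^^ j) p))"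
    by (simp add: partial_funpow_shift linear_sum[OF linear_shift])
qed

lift_definition pincherle :: "'d::finite \<Rightarrow> 'd sio \<Rightarrow> 'd sio"
  is "\<lambda>j L p. L (X j * p) - X j * L p"
proof (intro conjI allI)
  fix j :: 'd and L :: "'d rpoly \<Rightarrow> 'd rpoly"
  assume "linear L \<and> (\<forall>v p. L (shift v p) = shift v (L p))"
  hence L: "linear L" and shift: "\<And>v p. shift v (L p) = L (shift v p)" by auto
  note L_simps = linear_add[OF L] linear_scale[OF L]
  show "linear (\<lambda>p. L (X j * p) - X j * L p)"
    by (rule linearI) (simp_all add: L_simps algebra_simps)
  fix v p
  have "of_real c * q = c *\<^sub>R q" for c and q :: "'d rpoly"
    by (simp add: of_real_def)
  thus "L (X j * shift v p) - X j * L (shift v p) = shift v (L (X j * p) - X j * L p)"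
    by (simp add: shift L_simps algebra_simps)
qed

text \<open>The inverse of a unit; unspecified for non-units.\<close>

definition unit_inv :: "'a::comm_monoid_mult \<Rightarrow> 'a" where
  "unit_inv a = (THE b. a * b = 1)"

lemma unit_inv_eqI: "a * b = 1 \<Longrightarrow> unit_inv a = b"
  unfolding unit_inv_def by (rule the_equality) (auto, metis mult.assoc mult.commute mult_1_right)


lemma unit_inv_shift_op: "unit_inv (shift_op v) = shift_op (- v)"
proof (rule unit_inv_eqI, rule sio_eqI, rule rpoly_eqI)
  have "app (shift_op w) p = shift w p" for w :: "real ^ 'a" and p by transfer simp
  thus "ev (app (shift_op v * shift_op (- v)) p) x = ev (app 1 p) x" for p x by simp
qed


section \<open>Basic sequences and delta Goncarov polynomials\<close>

text \<open>
  The sequence \<open>p\<close> consists of univariate polynomials; the operator \<open>Q\<close> acts on them as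
  polynomials in the variable \<open>X i\<close>.
\<close>

definition basic_sequence :: "'d::finite \<Rightarrow> 'd sio \<Rightarrow> (nat \<Rightarrow> real poly) \<Rightarrow> bool" where
  "basic_sequence i Q p \<longleftrightarrow>
     (\<forall>n. degree (p n) = n) \<and> p 0 = 1 \<and> (\<forall>n\<ge>1. poly (p n) 0 = 0) \<and>
     (\<forall>n. app Q (psubst (p n) (X i)) = real n *\<^sub>R psubst (p (n - 1)) (X i))"

definition basic_poly :: "('d::finite \<Rightarrow> nat \<Rightarrow> real poly) \<Rightarrow> nat ^ 'd \<Rightarrow> 'd rpoly" where
  "basic_poly p n = (\<Prod>i\<in>UNIV. psubst (p i (n $ i)) (X i))"

definition poly_space :: "('d::finite \<Rightarrow> nat \<Rightarrow> real poly) \<Rightarrow> nat ^ 'd \<Rightarrow> 'd rpoly set" where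
  "poly_space p n = span {basic_poly p k | k. k \<le> n}"

definition delta_goncarov ::
  "('d::finite \<Rightarrow> 'd sio) \<Rightarrow> ('d \<Rightarrow> nat \<Rightarrow> real poly) \<Rightarrow> (nat ^ 'd \<Rightarrow> real ^ 'd) \<Rightarrow> nat ^ 'd \<Rightarrow> 'd rpoly"
where
  "delta_goncarov Q p z n = (THE t. t \<in> poly_space p n \<and>
     (\<forall>k\<le>n. ev (app (\<Prod>i\<in>UNIV. Q i ^ (k $ i)) t) (z k) =
        (if k = n then \<Prod>i\<in>UNIV. fact (n $ i) else 0)))"

end

theory Submission
  imports Defs
begin

text \<open>
  Put \<open>T\<^sub>n = det ((S\<^sub>i)') \<Prod>\<^sub>i (L\<^sub>i E\<^sub>i)\<^sup>-\<^sup>n\<^sup>-\<^sup>1 x\<^sup>n\<close>, where \<open>E\<^sub>i\<close> is the shift by the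
  \<open>i\<close>-th column of \<open>A\<close>. Since \<open>S\<^sub>i = D\<^sub>i L\<^sub>i E\<^sub>i\<close>, the operator \<open>S\<^sub>i\<close> maps \<open>T\<^sub>n\<close> to
  \<open>n\<^sub>i T\<^sub>m\<close> with \<open>m = n - e\<^sub>i\<close>, and evaluating \<open>Q\<^sup>k T\<^sub>n\<close> at \<open>z\<^sub>k\<close> amounts to evaluating
  \<open>S\<^sup>k T\<^sub>n\<close> at the origin. So the interpolation conditions reduce to \<open>T\<^sub>0 = 1\<close> and
  \<open>T\<^sub>n(0) = 0\<close> for \<open>n \<noteq> 0\<close>.

  After the shifts are taken out, row \<open>i\<close> of the operator determinant involves \<open>D\<^sub>i\<close> alone.
  Applied to a product of univariate polynomials it is therefore a determinant of polynomials,
  whose entries the univariate transfer formulas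
  \<open>p\<^sub>n = Q' L\<^sup>-\<^sup>n\<^sup>-\<^sup>1 x\<^sup>n = x L\<^sup>-\<^sup>n x\<^sup>n\<^sup>-\<^sup>1\<close> identify. This is the formula with \<open>det (B + C)\<close>,
  and at the origin this determinant has an explicit nonzero left kernel vector unless \<open>n = 0\<close>.
\<close>

section \<open>Operators in a single variable\<close>

declare shift_op.rep_eq [simp] diff_op.rep_eq [simp] pincherle.rep_eq [simp]

lemma app_sum: "app (sum R I) f = (\<Sum>i\<in>I. app (R i) f)"
  by (induction I rule: infinite_finite_induct) auto

lemma app_arg_sum: "app R (sum f I) = (\<Sum>i\<in>I. app R (f i))"
  by (rule linear_sum[OF linear_app])

lemma app_arg_diff [simp]: "app R (f - g) = app R f - app R g"
  by (rule linear_diff[OF linear_app])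

lemma app_of_nat [simp]: "app (of_nat k) f = of_nat k * f"
  by (induction k) (auto simp: algebra_simps)

lemma app_of_int [simp]: "app (of_int k) f = of_int k * f"
  by (cases k rule: int_diff_cases) (simp_all add: left_diff_distrib)

lemma ev_of_nat [simp]: "ev (of_nat k) x = of_nat k"
  by (metis ev_of_real of_real_of_nat_eq)

lemma shift_of_nat [simp]: "shift v (of_nat k) = of_nat k"
  by (rule rpoly_eqI) simp

lemma ev_of_int [simp]: "ev (of_int k) x = of_int k"
  by (metis ev_of_real of_real_of_int_eq)

lemma ev_prod: "ev (prod f I) x = (\<Prod>i\<in>I. ev (f i) x)"
  by (induction I rule: infinite_finite_induct) auto

lemma ev_power [simp]: "ev (f ^ k) x = ev f x ^ k"
  by (induction k) auto

lemma ev_det: "ev (det M) x = det (\<chi> i j. ev (M $ i $ j) x)"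
  by (simp add: det_def ev_prod)

lemma shift_of_int [simp]: "shift v (of_int k) = of_int k"
  by (rule rpoly_eqI) simp

lemma shift_prod: "shift v (prod f I) = (\<Prod>i\<in>I. shift v (f i))"
  by (induction I rule: infinite_finite_induct) auto

lemma shift_sum: "shift v (sum f I) = (\<Sum>i\<in>I. shift v (f i))"
  by (induction I rule: infinite_finite_induct) auto

lemma shift_det: "shift v (det M) = det (\<chi> i j. shift v (M $ i $ j))"
  by (simp add: det_def shift_prod shift_sum)

section \<open>Polynomials that are constant in some of the variables\<close>

lemma ev_line_const:
  assumes "partial j f = 0"
  shows "ev f (x + h *\<^sub>R axis j 1) = ev f x"
proof -
  have "((\<lambda>h. ev f (x + h *\<^sub>R axis j 1)) has_real_derivative 0) (at h)" for h
  proof -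
    \<comment> \<open>\<open>has_partial\<close> differentiates at parameter 0 only, so the base
      point is moved along the line to parameter \<open>h\<close>.\<close>
    have "((\<lambda>k. ev f (x + (k + h) *\<^sub>R axis j 1)) has_real_derivative 0) (at 0)"
      using has_partial[of f "x + h *\<^sub>R axis j 1" j] assms by (simp add: algebra_simps)
    thus ?thesis
      using DERIV_shift[of "\<lambda>h. ev f (x + h *\<^sub>R axis j 1)" 0 0 h] by simp
  qed
  from DERIV_isconst_all[of _ h 0, OF allI, OF this] show ?thesis by simp
qed

text \<open>The coordinates outside \<open>I\<close> are set to zero one at a time, each along a
  line on which \<open>f\<close> is constant.\<close>

lemma ev_restrict:
  assumes "\<And>j. j \<notin> I \<Longrightarrow> partial j f = 0"
  shows "ev f x = ev f (\<chi> i. if i \<in> I then x $ i else 0)"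
proof -
  have "ev f (\<chi> i. if i \<in> J then 0 else x $ i) = ev f x" if "finite J" "J \<subseteq> - I" for J
    using that
  proof induction
    case (insert j J)
    have "(\<chi> i. if i \<in> J then 0 else x $ i) =
        (\<chi> i. if i \<in> insert j J then 0 else x $ i) + (x $ j) *\<^sub>R axis j 1"
      using insert.hyps by (auto simp: vec_eq_iff axis_def)
    moreover have "partial j f = 0" using insert.prems assms by auto
    ultimately show ?case using insert ev_line_const[of j f] by simp
  qed simp
  from this[of "- I"] have "ev f x = ev f (\<chi> i. if i \<in> - I then 0 else x $ i)" by simp
  also have "(\<chi> i. if i \<in> - I then 0 else x $ i) = (\<chi> i. if i \<in> I then x $ i else 0)"
    by (simp add: vec_eq_iff)
  finally show ?thesis .
qed

lemma partial_zero_const: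
  assumes "\<And>j. partial j f = 0"
  shows "f = of_real (ev f x)"
proof (rule rpoly_eqI)
  fix y
  show "ev f y = ev (of_real (ev f x)) y"
    using ev_restrict[of "{}" f x] ev_restrict[of "{}" f y] assms by simp
qed

text \<open>Encoding polynomials in \<open>X i\<close> alone by partial derivatives makes closure
  under shift-invariant operators a matter of commutation; \<open>var_polyE\<close> recovers the
  univariate polynomial.\<close>

definition var_poly :: "'d::finite \<Rightarrow> 'd rpoly \<Rightarrow> bool" where
  "var_poly i f \<longleftrightarrow> (\<forall>j. j \<noteq> i \<longrightarrow> partial j f = 0)"

lemma psubst_0 [simp]: "psubst 0 f = 0"
  by (simp add: psubst_def)

lemma psubst_1 [simp]: "psubst 1 f = 1"
  by (rule rpoly_eqI) (simp add: ev_psubst)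

lemma psubst_pCons [simp]: "psubst (pCons a u) f = of_real a + f * psubst u f"
  by (simp add: psubst_def map_poly_pCons)

lemma shift_psubst: "shift v (psubst u f) = psubst u (shift v f)"
  by (rule rpoly_eqI) (simp add: ev_psubst)

lemma var_poly_psubst [simp]: "var_poly i (psubst u (X i))"
  by (induction u) (auto simp: var_poly_def axis_def)

lemma var_poly_power [simp]: "var_poly i (X i ^ n)"
  by (induction n) (auto simp: var_poly_def axis_def intro: partial_simps(4)[of _ 1, simplified])

lemma var_poly_app [simp]: "var_poly i f \<Longrightarrow> var_poly i (app R f)"
  unfolding var_poly_def by (metis app_arg_simps(1) diff_op.rep_eq sio_commute)

lemma var_polyE:
  fixes i :: "'d::finite"
  assumes "var_poly i f"
  obtains u where "f = psubst u (X i)"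
proof -
  have "polynomial_function (\<lambda>h::real. h *\<^sub>R axis i 1 :: real ^ 'd)"
    by (intro polynomial_function_const polynomial_function_mult polynomial_function_id)
  hence "real_polynomial_function (ev f \<circ> (\<lambda>h. h *\<^sub>R axis i 1))"
    using ev[of f] by blast
  then obtain c m where "ev f \<circ> (\<lambda>h. h *\<^sub>R axis i 1) = (\<lambda>t. \<Sum>k\<le>m. c k * t ^ k)"
    using real_polynomial_function_iff_sum by blast
  hence c: "ev f (h *\<^sub>R axis i 1) = (\<Sum>k\<le>m. c k * h ^ k)" for h
    by (simp add: fun_eq_iff)
  have "f = psubst (\<Sum>k\<le>m. monom (c k) k) (X i)"
  proof (rule rpoly_eqI)
    fix x :: "real ^ 'd"
    \<comment> \<open>\<open>f\<close> is determined by its restriction to the \<open>i\<close>-th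
      axis, which is the univariate polynomial with coefficients \<open>c\<close>.\<close>
    have "ev f x = ev f (\<chi> j. if j \<in> {i} then x $ j else 0)"
      by (rule ev_restrict) (use assms in \<open>auto simp: var_poly_def\<close>)
    also have "(\<chi> j. if j \<in> {i} then x $ j else 0) = x $ i *\<^sub>R axis i 1"
      by (auto simp: vec_eq_iff axis_def)
    finally show "ev f x = ev (psubst (\<Sum>k\<le>m. monom (c k) k) (X i)) x"
      by (simp add: c ev_psubst poly_sum poly_monom)
  qed
  thus thesis by (rule that)
qed

text \<open>These operators are the power series in \<open>D\<^sub>i\<close> alone.\<close>

definition var_op :: "'d::finite \<Rightarrow> 'd sio \<Rightarrow> bool" where
  "var_op i R \<longleftrightarrow> (\<forall>j f. j \<noteq> i \<longrightarrow> app R (X j * f) = X j * app R f)"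

lemma var_op_mult_left:
  assumes "var_op i R" "var_poly j f" "i \<noteq> j"
  shows "app R (f * g) = f * app R g"
proof -
  obtain u where "f = psubst u (X j)" using var_polyE assms(2) .
  moreover have "app R (psubst u (X j) * g) = psubst u (X j) * app R g"
    using assms by (induction u) (auto simp: var_op_def distrib_right mult.assoc scaleR_conv_of_real[symmetric])
  ultimately show ?thesis by simp
qed

text \<open>Each \<open>R i\<close> treats factors in the other variables as scalars, so it reaches
  only its own factor.\<close>

lemma app_prod:
  assumes "\<And>i. i \<in> I \<Longrightarrow> var_op i (R i)" "\<And>i. i \<in> I \<Longrightarrow> var_poly i (f i)"
  shows "app (prod R I) (prod f I) = (\<Prod>i\<in>I. app (R i) (f i))"
  using assms
proof (induction I rule: infinite_finite_induct)
  case (insert a I)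
  note R = insert.prems(1) and f = insert.prems(2)
  \<comment> \<open>The other operators pass over \<open>f a\<close>; in the next fact
    \<open>R a\<close> passes over the factors already processed.\<close>
  have 1: "app (prod R J) (f a * g) = f a * app (prod R J) g" if "finite J" "J \<subseteq> I" for J g
    using that
  proof induction
    case (insert j J)
    hence "app (R j) (f a * app (prod R J) g) = f a * app (R j) (app (prod R J) g)"
      using \<open>a \<notin> I\<close> by (intro var_op_mult_left[of j _ a] R f) auto
    thus ?case using insert by simp
  qed simp
  have 2: "app (R a) ((\<Prod>i\<in>J. app (R i) (f i)) * g) = (\<Prod>i\<in>J. app (R i) (f i)) * app (R a) g"
    if "finite J" "J \<subseteq> I" for J g
    using that
  proof (induction arbitrary: g)
    case (insert j J)
    hence "app (R a) (app (R j) (f j) * ((\<Prod>i\<in>J. app (R i) (f i)) * g)) =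
        app (R j) (f j) * app (R a) ((\<Prod>i\<in>J. app (R i) (f i)) * g)"
      using \<open>a \<notin> I\<close> by (intro var_op_mult_left[of a _ j] var_poly_app R f) auto
    thus ?case using insert by (simp add: mult.assoc)
  qed simp
  have "app (prod R (insert a I)) (prod f (insert a I)) = app (R a) (app (prod R I) (f a * prod f I))"
    using insert.hyps by simp
  also have "\<dots> = app (R a) ((\<Prod>i\<in>I. app (R i) (f i)) * f a)"
    using insert.hyps insert.IH R f by (simp only: 1 subset_refl insertI2 mult.commute)
  also have "\<dots> = (\<Prod>i\<in>insert a I. app (R i) (f i))"
    using insert.hyps 2[of I "f a"] by (simp add: mult.commute)
  finally show ?case .
qed auto

text \<open>Every Leibniz term takes one entry from each row, and row \<open>i\<close> acts on
  \<open>f i\<close> only, so \<open>app_prod\<close> applies term by term.\<close>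

lemma app_det:
  assumes "\<And>i j. var_op i (M $ i $ j)" "\<And>i. var_poly i (f i)"
  shows "app (det M) (\<Prod>i\<in>UNIV. f i) = det (\<chi> i j. app (M $ i $ j) (f i))"
  unfolding det_def by (simp add: app_sum app_prod assms)

lemma var_op_simps [simp]:
  "var_op i 1" "var_op i (diff_op i)"
  "var_op i R \<Longrightarrow> var_op i T \<Longrightarrow> var_op i (R + T)"
  "var_op i R \<Longrightarrow> var_op i T \<Longrightarrow> var_op i (R * T)"
  "var_op i R \<Longrightarrow> var_op i (a *\<^sub>R R)"
  by (auto simp: var_op_def distrib_left axis_def)

lemma var_op_power [simp]: "var_op i R \<Longrightarrow> var_op i (R ^ k)"
  by (induction k) auto

lemma var_op_pincherle [simp]: "var_op i R \<Longrightarrow> var_op i (pincherle i R)"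
  unfolding var_op_def
proof safe
  fix j f assume R: "\<forall>j f. j \<noteq> i \<longrightarrow> app R (X j * f) = X j * app R f" and "j \<noteq> i"
  hence "app R (X j * (X i * f)) = X j * app R (X i * f)" "app R (X j * f) = X j * app R f"
    by blast+
  thus "app (pincherle i R) (X j * f) = X j * app (pincherle i R) f"
    by (simp add: right_diff_distrib mult.left_commute[of _ "X j"])
qed

lemma var_op_inverse:
  assumes "var_op i R" "R * T = 1"
  shows "var_op i T"
  unfolding var_op_def
proof safe
  fix j f assume j: "j \<noteq> i"
  have RT: "app R (app T g) = g" "app T (app R g) = g" for g
    using assms(2) app_simps(6)[of R T g] app_simps(6)[of T R g] by (simp_all add: mult.commute[of T])
  \<comment> \<open>Commutation of \<open>R\<close> is used at \<open>app T f\<close>; applying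
    \<open>T\<close> then cancels \<open>R\<close>.\<close>
  show "app T (X j * f) = X j * app T f"
    using assms(1)[unfolded var_op_def, rule_format, OF j, of "app T f"] RT by metis
qed

section \<open>Series in a single derivative\<close>

lemma app_series_op:
  assumes "(partial i ^^ k) f = 0"
  shows "app (series_op i c) f = (\<Sum>j<k. c j *\<^sub>R (partial i ^^ j) f)"
  unfolding series_op.rep_eq
proof (rule Sum_any.expand_superset)
  show "{j. c j *\<^sub>R (partial i ^^ j) f \<noteq> 0} \<subseteq> {..<k}"
    using partial_nilpotent_mono[OF assms] by (auto simp: not_le[symmetric])
qed simp

lemma partial_power_mult_X: "j \<noteq> i \<Longrightarrow> (partial i ^^ k) (X j * f) = X j * (partial i ^^ k) f"
  by (induction k) (auto simp: axis_def)

lemma var_op_series_op [simp]: "var_op i (series_op i c)"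
  unfolding var_op_def
proof safe
  fix j f assume j: "j \<noteq> i"
  obtain k where k: "(partial i ^^ k) f = 0" using partial_nilpotent by blast
  hence "(partial i ^^ k) (X j * f) = 0" by (simp add: partial_power_mult_X j)
  from app_series_op[OF this] app_series_op[OF k]
  show "app (series_op i c) (X j * f) = X j * app (series_op i c) f"
    by (simp add: partial_power_mult_X j sum_distrib_left)
qed

text \<open>Composition is the Cauchy product of the coefficients; on a fixed \<open>f\<close> both
  series are truncated at an index \<open>k\<close> that kills \<open>f\<close>.\<close>

lemma series_op_mult:
  "series_op i c * series_op i d = series_op i (\<lambda>s. \<Sum>j\<le>s. c j * d (s - j))"
proof (rule sio_eqI)
  fix f
  obtain k where k: "(partial i ^^ k) f = 0" using partial_nilpotent by blast
  have nonzero: "s < k" if "(partial i ^^ s) f \<noteq> 0" for s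
    using partial_nilpotent_mono[OF k, of s] that by (meson not_less)
  have partial_app: "(partial i ^^ a) (app R f) = app R ((partial i ^^ a) f)" for a R
    by (induction a) (auto, metis diff_op.rep_eq sio_commute)
  have "(partial i ^^ k) (app (series_op i d) f) = 0"
    by (simp add: partial_app k)
  from app_series_op[OF this]
  have "app (series_op i c * series_op i d) f =
      (\<Sum>a<k. c a *\<^sub>R (partial i ^^ a) (\<Sum>b<k. d b *\<^sub>R (partial i ^^ b) f))"
    by (simp add: app_series_op[OF k])
  also have "\<dots> = (\<Sum>a<k. \<Sum>b<k. (c a * d b) *\<^sub>R (partial i ^^ (a + b)) f)"
    by (simp add: linear_sum[OF linear_partial_funpow] linear_scale[OF linear_partial_funpow]
        scaleR_sum_right funpow_add)
  also have "\<dots> = (\<Sum>(a, b)\<in>{..<k} \<times> {..<k}. (c a * d b) *\<^sub>R (partial i ^^ (a + b)) f)"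
    by (rule sum.cartesian_product)
  \<comment> \<open>Terms with \<open>a + b >= k\<close> vanish, so the square of indices shrinks to
    the triangle, which is then summed by diagonals.\<close>
  also have "\<dots> = (\<Sum>(a, b)\<in>{(a, b). a + b < k}. (c a * d b) *\<^sub>R (partial i ^^ (a + b)) f)"
    by (rule sum.mono_neutral_right) (auto dest: nonzero)
  also have "\<dots> = (\<Sum>s<k. \<Sum>a\<le>s. (c a * d (s - a)) *\<^sub>R (partial i ^^ s) f)"
    by (subst sum.triangle_reindex) auto
  also have "\<dots> = app (series_op i (\<lambda>s. \<Sum>j\<le>s. c j * d (s - j))) f"
    by (simp add: app_series_op[OF k] scaleR_left.sum)
  finally show "app (series_op i c * series_op i d) f =
      app (series_op i (\<lambda>s. \<Sum>j\<le>s. c j * d (s - j))) f" .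
qed

text \<open>The inverse operator takes its coefficients from the inverse formal power series, which
  exists because the constant coefficient is nonzero.\<close>

lemma series_op_unit:
  assumes "c 0 \<noteq> 0"
  obtains T where "series_op i c * T = 1"
proof -
  let ?f = "Abs_fps c"
  have 1: "?f * inverse ?f = 1"
    using assms by (metis fps_nth_Abs_fps inverse_mult_eq_1 mult.commute)
  have "(\<lambda>s. \<Sum>j\<le>s. c j * fps_nth (inverse ?f) (s - j)) = (\<lambda>s. if s = 0 then 1 else 0)"
  proof
    fix s
    have "(\<Sum>j\<le>s. c j * fps_nth (inverse ?f) (s - j)) = fps_nth (?f * inverse ?f) s"
      by (simp only: fps_mult_nth atLeast0AtMost fps_nth_Abs_fps)
    thus "(\<Sum>j\<le>s. c j * fps_nth (inverse ?f) (s - j)) = (if s = 0 then 1 else 0)"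
      by (simp add: 1)
  qed
  moreover have "series_op i (\<lambda>s. if s = 0 then 1 else 0) = 1"
  proof (rule sio_eqI)
    fix f
    obtain k where "(partial i ^^ k) f = 0" using partial_nilpotent by blast
    \<comment> \<open>\<open>Suc k\<close> keeps the truncated range nonempty, so that the term for
      index 0 can be split off.\<close>
    hence "(partial i ^^ Suc k) f = 0" by (rule partial_nilpotent_mono) simp
    from app_series_op[OF this]
    show "app (series_op i (\<lambda>s. if s = 0 then 1 else 0)) f = app 1 f"
      by (simp add: sum.lessThan_Suc_shift del: sum.lessThan_Suc)
  qed
  ultimately show thesis by (intro that[of "series_op i (fps_nth (inverse ?f))"]) (simp add: series_op_mult)
qed

section \<open>The Pincherle derivation\<close>

lemma pincherle_mult: "pincherle j (R * T) = pincherle j R * T + R * pincherle j T"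
  by (rule sio_eqI) simp

lemma pincherle_simps [simp]:
  "pincherle j 1 = 0"
  "pincherle j (diff_op i) = (if i = j then 1 else 0)"
  "pincherle j (shift_op v) = (v $ j) *\<^sub>R shift_op v"
  by (rule sio_eqI; simp add: axis_def distrib_right scaleR_conv_of_real[symmetric])+

lemma pincherle_var_op: "var_op i R \<Longrightarrow> j \<noteq> i \<Longrightarrow> pincherle j R = 0"
  by (rule sio_eqI) (simp add: var_op_def)

text \<open>Differentiating \<open>R * T = 1\<close> and multiplying by \<open>T\<close> gives the
  derivative of the inverse; powers follow from the product rule by induction.\<close>

lemma pincherle_inverse_power:
  assumes "R * T = 1"
  shows "pincherle j (T ^ Suc k) = - of_nat (Suc k) * pincherle j R * T ^ (k + 2)"
proof -
  have "pincherle j R * T + R * pincherle j T = 0"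
    by (metis assms pincherle_mult pincherle_simps(1))
  hence "T * (pincherle j R * T + R * pincherle j T) = 0" by simp
  hence "pincherle j R * T * T + (R * T) * pincherle j T = 0"
    by (simp add: algebra_simps)
  hence T: "pincherle j T = - pincherle j R * T * T"
    by (simp add: assms eq_neg_iff_add_eq_0 add.commute)
  show ?thesis
  proof (induction k)
    case (Suc k)
    have "pincherle j (T ^ Suc (Suc k)) = pincherle j T * T ^ Suc k + T * pincherle j (T ^ Suc k)"
      by (simp only: power_Suc pincherle_mult)
    also have "\<dots> = - of_nat (Suc (Suc k)) * pincherle j R * T ^ (Suc k + 2)"
      unfolding Suc by (simp add: T algebra_simps)
    finally show ?case .
  qed (simp add: T)
qed

section \<open>Basic sequences\<close>

text \<open>Serves both \<open>Q i\<close> on its basic sequence and \<open>diff_op i\<close> on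
  monomials. At \<open>n = 0\<close> the coefficient 0 covers the truncated index
  \<open>n - 1\<close>.\<close>

lemma lowering_power:
  assumes "\<And>n. app Q (q n) = real n *\<^sub>R q (n - 1)"
  shows "app (Q ^ k) (q n) = (if k \<le> n then (fact n / fact (n - k)) *\<^sub>R q (n - k) else 0)"
proof (induction k)
  case (Suc k)
  show ?case
  proof (cases "Suc k \<le> n")
    case True
    hence "n - k = Suc (n - Suc k)" by simp
    hence "fact (n - k) = real (n - k) * fact (n - Suc k)" "real (n - k) \<noteq> 0" by simp_all
    thus ?thesis using Suc True assms[of "n - k"] by simp
  next
    case False
    hence "k \<le> n \<Longrightarrow> n - k = 0" by simp
    thus ?thesis using Suc False assms[of 0] by auto
  qed
qed simp

lemma partial_power_X: "partial i (X i ^ n) = real n *\<^sub>R X i ^ (n - 1)"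
proof (induction n)
  case (Suc n)
  thus ?case by (cases n) (simp_all add: algebra_simps scaleR_conv_of_real)
qed (use partial_simps(4)[of i 1] in simp)

text \<open>The product rule splits the derivative of \<open>Q\<close> into \<open>L\<close> and
  \<open>diff_op i\<close> times the derivative of \<open>L\<close>. After \<open>diff_op i\<close>
  lowers the monomial, the second part is minus the derivative of \<open>K ^ Suc n\<close>, a
  commutator with \<open>X i\<close> that moves \<open>X i\<close> out of the operator.\<close>

lemma basic_sequence_transfer_X:
  assumes "L * K = 1" "Q = diff_op i * L"
  shows "app (pincherle i Q * K ^ (n + 2)) (X i ^ Suc n) = X i * app (K ^ Suc n) (X i ^ n)"
proof -
  have K: "L * K ^ Suc m = K ^ m" for m
    using assms(1) by (simp add: mult.assoc[symmetric])
  have "pincherle i Q * K ^ (n + 2) = L * K ^ Suc (Suc n) + pincherle i L * K ^ (n + 2) * diff_op i"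
    by (simp add: assms(2) pincherle_mult algebra_simps)
  also have "\<dots> = K ^ Suc n + pincherle i L * K ^ (n + 2) * diff_op i"
    by (simp only: K)
  finally have "app (pincherle i Q * K ^ (n + 2)) (X i ^ Suc n) =
      app (K ^ Suc n) (X i ^ Suc n) + app (pincherle i L * K ^ (n + 2)) (real (Suc n) *\<^sub>R X i ^ n)"
    by (simp only: app_simps diff_op.rep_eq partial_power_X diff_Suc_1)
  also have "\<dots> = app (K ^ Suc n) (X i ^ Suc n) -
      app (- of_nat (Suc n) * pincherle i L * K ^ (n + 2)) (X i ^ n)"
  proof -
    have "- of_nat (Suc n) * pincherle i L * K ^ (n + 2) =
        (- real (Suc n)) *\<^sub>R (pincherle i L * K ^ (n + 2))"
      by (simp add: scaleR_conv_of_real algebra_simps)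
    thus ?thesis by (simp only: app_simps app_arg_simps scaleR_minus_left) simp
  qed
  also have "\<dots> = app (K ^ Suc n) (X i * X i ^ n) - app (pincherle i (K ^ Suc n)) (X i ^ n)"
    by (simp only: pincherle_inverse_power[OF assms(1)] power_Suc[of "X i"])
  also have "\<dots> = X i * app (K ^ Suc n) (X i ^ n)"
    by (simp del: power_Suc)
  finally show ?thesis .
qed

text \<open>Induction on \<open>n\<close>: both sides have the same image under \<open>Q\<close>, so
  their difference \<open>r\<close> is killed by \<open>K * Q = diff_op i\<close> and is constant.
  It vanishes at the origin because \<open>basic_sequence_transfer_X\<close> exhibits a factor
  \<open>X i\<close>.\<close>

lemma basic_sequence_transfer:
  assumes "basic_sequence i Q p" "L * K = 1" "Q = diff_op i * L"
  shows "psubst (p n) (X i) = app (pincherle i Q * K ^ Suc n) (X i ^ n)"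
proof (induction n)
  case 0
  have "pincherle i Q * K = 1 + pincherle i L * K * diff_op i"
    using assms(2) by (simp add: assms(3) pincherle_mult algebra_simps)
  hence "app (pincherle i Q * K) 1 = 1"
    using partial_simps(4)[of i 1] by simp
  thus ?case using assms(1) by (simp add: basic_sequence_def)
next
  case (Suc n)
  define q where "q = app (pincherle i Q * K ^ (n + 2)) (X i ^ Suc n)"
  define r where "r = psubst (p (Suc n)) (X i) - q"
  \<comment> \<open>One power of \<open>K\<close> cancels the \<open>L\<close> in \<open>Q\<close>;
    the remaining \<open>diff_op i\<close> lowers the monomial.\<close>
  have "Q * (pincherle i Q * K ^ (n + 2)) = (L * K) * (pincherle i Q * K ^ Suc n) * diff_op i"
    by (simp add: assms(3) algebra_simps)
  hence "app Q q = real (Suc n) *\<^sub>R app (pincherle i Q * K ^ Suc n) (X i ^ n)"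
    unfolding q_def app_simps(6)[symmetric] assms(2)
    by (simp only: mult_1 app_simps diff_op.rep_eq partial_power_X diff_Suc_1 app_arg_simps)
  moreover have "app Q (psubst (p (Suc n)) (X i)) = real (Suc n) *\<^sub>R psubst (p n) (X i)"
    using assms(1) unfolding basic_sequence_def by (metis diff_Suc_1)
  ultimately have "app (K * Q) r = 0" by (simp add: r_def Suc)
  moreover have "K * Q = diff_op i"
    by (simp add: assms(2,3) mult.left_commute[of K] mult.commute[of K L])
  ultimately have "partial i r = 0" by simp
  moreover have "partial j r = 0" if "j \<noteq> i" for j
  proof -
    have "var_poly i (psubst (p (Suc n)) (X i))" "var_poly i q"
      unfolding q_def by (intro var_poly_psubst var_poly_app var_poly_power)+
    with that have "partial j (psubst (p (Suc n)) (X i)) = 0" "partial j q = 0"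
      by (simp_all add: var_poly_def)
    thus ?thesis unfolding r_def by (metis app_arg_diff diff_0_right diff_op.rep_eq)
  qed
  ultimately have "r = of_real (ev r 0)" by (intro partial_zero_const) metis
  moreover have "ev r 0 = 0"
    using assms(1) unfolding r_def q_def basic_sequence_transfer_X[OF assms(2,3)]
    by (simp add: basic_sequence_def ev_psubst)
  ultimately show ?case by (simp add: r_def q_def)
qed

section \<open>Determinants\<close>

text \<open>For invertible \<open>q\<close> this is conjugation by a diagonal matrix. Division is
  avoided by comparing Leibniz terms: a permutation maps its moved points bijectively to themselves,
  so both terms collect the same factors \<open>q\<close>.\<close>

lemma det_diagonal_conjugate:
  fixes D M :: "'a::comm_ring_1 ^ 'd ^ 'd" and q :: "'d::finite \<Rightarrow> 'a"
  shows "det (\<chi> i j. (if i = j then d i else 0) + q i * M $ i $ j) =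
    det (\<chi> i j. (if i = j then d i else 0) + q j * M $ i $ j)"
proof -
  have "(\<Prod>i\<in>UNIV. (if i = s i then d i else 0) + q i * M $ i $ s i) =
      (\<Prod>i\<in>UNIV. (if i = s i then d i else 0) + q (s i) * M $ i $ s i)"
    if "s permutes UNIV" for s
  proof -
    have inj: "inj s" using that permutes_inj by blast
    have split: "prod f UNIV = prod f {i. s i = i} * prod f {i. s i \<noteq> i}" for f :: "'d \<Rightarrow> 'a"
      by (subst prod.union_disjoint[symmetric]) (auto intro: prod.cong)
    have "bij_betw s {i. s i \<noteq> i} {i. s i \<noteq> i}"
    proof (rule bij_betw_imageI)
      show "inj_on s {i. s i \<noteq> i}" using inj by (rule inj_on_subset) simp
      show "s ` {i. s i \<noteq> i} = {i. s i \<noteq> i}"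
        using inj that by (auto simp: inj_eq image_iff) (metis permutes_def)
    qed
    hence "(\<Prod>i | s i \<noteq> i. q (s i)) = (\<Prod>i | s i \<noteq> i. q i)"
      by (rule prod.reindex_bij_betw)
    moreover have "(\<Prod>i | s i \<noteq> i. (if i = s i then d i else 0) + q i * M $ i $ s i) =
        (\<Prod>i | s i \<noteq> i. q i) * (\<Prod>i | s i \<noteq> i. M $ i $ s i)"
      unfolding prod.distrib[symmetric] by (rule prod.cong) auto
    moreover have "(\<Prod>i | s i \<noteq> i. (if i = s i then d i else 0) + q (s i) * M $ i $ s i) =
        (\<Prod>i | s i \<noteq> i. q (s i)) * (\<Prod>i | s i \<noteq> i. M $ i $ s i)"
      unfolding prod.distrib[symmetric] by (rule prod.cong) auto
    moreover have "(\<Prod>i | s i = i. (if i = s i then d i else 0) + q i * M $ i $ s i) =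
        (\<Prod>i | s i = i. (if i = s i then d i else 0) + q (s i) * M $ i $ s i)"
      by (rule prod.cong) auto
    ultimately show ?thesis by (simp only: split)
  qed
  thus ?thesis unfolding det_def by (intro sum.cong) auto
qed

lemma det_eq_0_left_kernel:
  fixes M :: "real ^ 'd::finite ^ 'd"
  assumes "v \<noteq> 0" "v v* M = 0"
  shows "det M = 0"
proof (rule ccontr)
  assume "det M \<noteq> 0"
  then obtain N where "M ** N = mat 1"
    using invertible_det_nz[of M] unfolding invertible_def by blast
  hence "v = (v v* M) v* N" by (simp add: vector_matrix_mul_assoc)
  with assms show False by simp
qed

section \<open>Delta Abel polynomials\<close>

lemma shift_op_add: "shift_op (v + w) = shift_op v * shift_op w"
  by (rule sio_eqI) (simp add: shift_shift)

lemma shift_op_0 [simp]: "shift_op 0 = 1"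
  by (rule sio_eqI, rule rpoly_eqI) simp

lemma shift_op_power: "shift_op v ^ k = shift_op (real k *\<^sub>R v)"
  by (induction k) (simp_all add: shift_op_add algebra_simps)

lemma prod_shift_op: "(\<Prod>i\<in>I. shift_op (v i)) = shift_op (\<Sum>i\<in>I. v i)"
  by (induction I rule: infinite_finite_induct) (simp_all add: shift_op_add)

lemma finite_vec_le: "finite {k :: nat ^ 'd::finite. k \<le> n}"
proof (rule finite_subset)
  show "{k. k \<le> n} \<subseteq> vec_lambda ` (PiE UNIV (\<lambda>i. {..n $ i}))"
  proof
    fix k assume "k \<in> {k. k \<le> n}"
    hence "($) k \<in> PiE UNIV (\<lambda>i. {..n $ i})" by (auto simp: less_eq_vec_def)
    moreover have "k = vec_lambda (($) k)" by simp
    ultimately show "k \<in> vec_lambda ` (PiE UNIV (\<lambda>i. {..n $ i}))" by blast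
  qed
qed (simp add: finite_PiE)

lemma partial_power_monomial:
  fixes n :: "nat ^ 'd::finite"
  shows "app (\<Prod>i\<in>UNIV. diff_op i ^ (k i)) (\<Prod>i\<in>UNIV. X i ^ (n $ i)) =
     (\<Prod>i\<in>UNIV. if k i \<le> n $ i then (fact (n $ i) / fact (n $ i - k i)) *\<^sub>R X i ^ (n $ i - k i) else 0)"
proof -
  have *: "app (diff_op i ^ k) (X i ^ m) = (if k \<le> m then (fact m / fact (m - k)) *\<^sub>R X i ^ (m - k) else 0)"
    for i :: 'd and k m by (rule lowering_power) (simp add: partial_power_X)
  show ?thesis by (subst app_prod) (simp_all add: *)
qed

text \<open>The series are abstracted to invertible operators in one derivative; \<open>K i\<close>
  is the inverse of \<open>L i\<close>.\<close>

locale delta_system =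
  fixes L K Q :: "'d::finite \<Rightarrow> 'd sio" and p :: "'d \<Rightarrow> nat \<Rightarrow> real poly" and A :: "real ^ 'd ^ 'd"
  assumes LK: "\<And>i. L i * K i = 1" and var_L: "\<And>i. var_op i (L i)"
    and Q: "\<And>i. Q i = diff_op i * L i" and basic: "\<And>i. basic_sequence i (Q i) (p i)"
begin

lemma var_K [simp]: "var_op i (K i)"
  using var_op_inverse[OF var_L LK] .

lemma var_Q [simp]: "var_op i (Q i)"
  by (simp add: Q var_L)

lemma QK: "Q i * K i = diff_op i"
  by (simp add: Q mult.assoc LK)

lemma basic_simps [simp]: "p i 0 = 1" "m > 0 \<Longrightarrow> poly (p i m) 0 = 0"
  using basic[of i] by (simp_all add: basic_sequence_def)

lemma Q_power_basic:
  "app (Q i ^ k) (psubst (p i m) (X i)) =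
     (if k \<le> m then (fact m / fact (m - k)) *\<^sub>R psubst (p i (m - k)) (X i) else 0)"
  by (rule lowering_power) (use basic[of i] in \<open>simp add: basic_sequence_def\<close>)

lemma app_basic_poly:
  "app (\<Prod>i\<in>UNIV. Q i ^ (k i)) (basic_poly p m) =
     (\<Prod>i\<in>UNIV. app (Q i ^ k i) (psubst (p i (m $ i)) (X i)))"
  unfolding basic_poly_def by (rule app_prod) auto

section \<open>Uniqueness of interpolation and an operator description of
  \<open>poly_space\<close>\<close>

lemma Q_power_prod: "(\<Prod>j\<in>UNIV. Q j ^ (if j = i then k else 0)) = Q i ^ k"
  by (subst prod.cong[OF refl, of _ _ "\<lambda>j. if j = i then Q j ^ k else 1"]) auto

text \<open>Downward induction on the exponent \<open>k\<close>: beyond \<open>n\<close> the degree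
  condition applies; below, all partial derivatives vanish by induction, so the polynomial is
  constant, and its value at \<open>w k\<close> is 0. The nodes are the origin in
  \<open>poly_space_iff\<close> and \<open>node\<close> in the uniqueness proof.\<close>

lemma eq_0_if_interpolates_0:
  fixes n :: "nat ^ 'd"
  assumes deg: "\<And>i. app (Q i ^ Suc (n $ i)) t = 0"
    and zero: "\<And>k. k \<le> n \<Longrightarrow> ev (app (\<Prod>i\<in>UNIV. Q i ^ (k $ i)) t) (w k) = 0"
  shows "t = 0"
proof -
  have "app (\<Prod>i\<in>UNIV. Q i ^ (k $ i)) t = 0" for k :: "nat ^ 'd"
  \<comment> \<open>With \<open>Suc\<close>, raising an exponent that equals \<open>n $ i\<close>
    still decreases the measure.\<close>
  proof (induction "\<Sum>i\<in>UNIV. Suc (n $ i) - k $ i" arbitrary: k rule: less_induct)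
    case less
    show ?case
    proof (cases "k \<le> n")
      case False
      then obtain i where "n $ i < k $ i" by (auto simp: less_eq_vec_def not_le)
      hence i: "Suc (n $ i) \<le> k $ i" by simp
      have "(\<Prod>j\<in>UNIV. Q j ^ (k $ j)) = Q i ^ (k $ i) * (\<Prod>j\<in>UNIV - {i}. Q j ^ (k $ j))"
        by (rule prod.remove) auto
      also have "Q i ^ (k $ i) = Q i ^ (k $ i - Suc (n $ i)) * Q i ^ Suc (n $ i)"
        using i by (metis le_add_diff_inverse2 power_add)
      finally have "(\<Prod>j\<in>UNIV. Q j ^ (k $ j)) =
          (Q i ^ (k $ i - Suc (n $ i)) * (\<Prod>j\<in>UNIV - {i}. Q j ^ (k $ j))) * Q i ^ Suc (n $ i)"
        by (simp only: mult_ac)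
      thus ?thesis by (simp only: app_simps(6) deg app_arg_simps)
    next
      case True
      let ?u = "app (\<Prod>i\<in>UNIV. Q i ^ (k $ i)) t"
      have "partial i ?u = 0" for i
      proof -
        let ?k = "\<chi> j. if j = i then Suc (k $ j) else k $ j"
        have "(\<Sum>j\<in>UNIV. Suc (n $ j) - ?k $ j) < (\<Sum>j\<in>UNIV. Suc (n $ j) - k $ j)"
          using True by (intro sum_strict_mono_ex1) (auto simp: less_eq_vec_def Suc_diff_le intro!: exI[of _ i])
        from less(1)[OF this] have "app (\<Prod>j\<in>UNIV. Q j ^ (?k $ j)) t = 0" .
        moreover have "(\<Prod>j\<in>UNIV. Q j ^ (?k $ j)) =
            (\<Prod>j\<in>UNIV. Q j ^ (if j = i then 1 else 0)) * (\<Prod>j\<in>UNIV. Q j ^ (k $ j))"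
          unfolding prod.distrib[symmetric] by (rule prod.cong) auto
        ultimately have "app (Q i) ?u = 0" by (simp add: Q_power_prod)
        hence "app (Q i * K i) ?u = 0" by (simp add: mult.commute[of "Q i"])
        thus ?thesis by (simp add: QK)
      qed
      from partial_zero_const[OF this, of "w k"] zero[OF True] show ?thesis by simp
    qed
  qed
  from this[of 0] show "t = 0" by simp
qed

lemma Q_power_poly_space:
  assumes "t \<in> poly_space p n"
  shows "app (Q i ^ Suc (n $ i)) t = 0"
proof -
  have "app (Q i ^ Suc (n $ i)) (basic_poly p m) = 0" if "m \<le> n" for m
  proof -
    have "\<not> Suc (n $ i) \<le> m $ i" using that by (simp add: less_eq_vec_def not_less Suc_le_eq)
    hence "app (Q i ^ Suc (n $ i)) (psubst (p i (m $ i)) (X i)) = 0"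
      by (simp only: Q_power_basic if_False)
    thus ?thesis
      using app_basic_poly[of "\<lambda>j. if j = i then Suc (n $ i) else 0" m]
      by (auto simp: Q_power_prod simp del: power_Suc intro!: exI[of _ i])
  qed
  hence "basic_poly p ` {m. m \<le> n} \<subseteq> {t. app (Q i ^ Suc (n $ i)) t = 0}" by blast
  hence "span (basic_poly p ` {m. m \<le> n}) \<subseteq> {t. app (Q i ^ Suc (n $ i)) t = 0}"
    by (rule span_minimal) (simp add: subspace_def del: power_Suc)
  thus ?thesis
    using assms unfolding poly_space_def by (auto simp: setcompr_eq_image)
qed

text \<open>For the converse, \<open>s\<close> is the Taylor expansion of \<open>t\<close> in the
  basic polynomials; \<open>t - s\<close> has zero data at the origin, hence is 0.\<close>

lemma poly_space_iff: "t \<in> poly_space p n \<longleftrightarrow> (\<forall>i. app (Q i ^ Suc (n $ i)) t = 0)"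
proof (intro iffI allI Q_power_poly_space)
  assume t: "\<forall>i. app (Q i ^ Suc (n $ i)) t = 0"
  define a where "a k = ev (app (\<Prod>i\<in>UNIV. Q i ^ (k $ i)) t) 0 / (\<Prod>i\<in>UNIV. fact (k $ i))" for k
  define s where "s = (\<Sum>k | k \<le> n. a k *\<^sub>R basic_poly p k)"
  have s: "s \<in> poly_space p n"
    unfolding s_def poly_space_def by (intro span_sum span_scale span_base) auto
  have at_0: "ev (app (\<Prod>i\<in>UNIV. Q i ^ (k $ i)) (basic_poly p m)) 0 =
      (if m = k then \<Prod>i\<in>UNIV. fact (k $ i) else 0)" for k m
  proof -
    have "ev (app (Q i ^ (k $ i)) (psubst (p i (m $ i)) (X i))) 0 =
        (if m $ i = k $ i then fact (k $ i) else 0)" for i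
      by (auto simp: Q_power_basic ev_psubst)
    thus ?thesis by (auto simp: app_basic_poly ev_prod vec_eq_iff)
  qed
  have "t - s = 0"
  proof (rule eq_0_if_interpolates_0)
    fix i
    show "app (Q i ^ Suc (n $ i)) (t - s) = 0"
      using t Q_power_poly_space[OF s] by (simp only: app_arg_diff diff_0_right)
  next
    fix k assume "k \<le> n"
    have "ev (app (\<Prod>i\<in>UNIV. Q i ^ (k $ i)) s) 0 = (\<Sum>m | m \<le> n. if m = k then a k * (\<Prod>i\<in>UNIV. fact (k $ i)) else 0)"
      unfolding s_def app_arg_sum ev_sum by (intro sum.cong) (auto simp: at_0)
    also have "\<dots> = ev (app (\<Prod>i\<in>UNIV. Q i ^ (k $ i)) t) 0"
      using \<open>k \<le> n\<close> by (simp add: finite_vec_le a_def)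
    finally show "ev (app (\<Prod>i\<in>UNIV. Q i ^ (k $ i)) (t - s)) 0 = 0" by simp
  qed
  thus "t \<in> poly_space p n" using s by simp
qed

section \<open>The Abel polynomials and their determinant formulas\<close>

definition node :: "nat ^ 'd \<Rightarrow> real ^ 'd" where
  "node n = A *v (\<chi> i. real (n $ i))"

abbreviation "E i \<equiv> shift_op (column i A)"
abbreviation "E' i \<equiv> shift_op (- column i A)"

definition abel :: "nat ^ 'd \<Rightarrow> 'd rpoly" where
  "abel n = app (det (\<chi> i j. pincherle j (Q i * E i)) *
     (\<Prod>i\<in>UNIV. K i ^ (n $ i + 1)) * (\<Prod>i\<in>UNIV. E' i ^ (n $ i + 1))) (\<Prod>i\<in>UNIV. X i ^ (n $ i))"

text \<open>This is the matrix of derivatives of \<open>Q i * E i\<close> with \<open>E i\<close>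
  taken out of row \<open>i\<close>. The shift is by a column of \<open>A\<close>, hence the
  transposed entry. Row \<open>i\<close> involves \<open>diff_op i\<close> alone, as
  \<open>app_det\<close> requires.\<close>

definition row_matrix :: "'d sio ^ 'd ^ 'd" where
  "row_matrix = (\<chi> i j. (if i = j then pincherle i (Q i) else 0) + A $ j $ i *\<^sub>R Q i)"

lemma EE': "E i * E' i = 1"
  by (simp add: shift_op_add[symmetric])

lemma node_eq: "node n = (\<Sum>i\<in>UNIV. real (n $ i) *\<^sub>R column i A)"
  by (simp add: node_def vec_eq_iff matrix_vector_mult_def column_def mult.commute)

lemma prod_E: "(\<Prod>i\<in>UNIV. E i ^ (n $ i)) = shift_op (node n)"
  by (simp add: shift_op_power prod_shift_op node_eq)

lemma prod_E': "(\<Prod>i\<in>UNIV. E' i ^ (n $ i)) = shift_op (- node n)"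
  by (simp add: shift_op_power prod_shift_op node_eq sum_negf)

text \<open>Each \<open>E i\<close> taken out of its row cancels one factor
  \<open>E' i\<close>.\<close>

lemma abel_eq:
  "abel n = app (det row_matrix * (\<Prod>i\<in>UNIV. K i ^ (n $ i + 1)) * (\<Prod>i\<in>UNIV. E' i ^ (n $ i)))
     (\<Prod>i\<in>UNIV. X i ^ (n $ i))"
proof -
  have "pincherle j (Q i) = 0" if "i \<noteq> j" for i j
    using that by (intro pincherle_var_op[of i]) auto
  hence "(\<chi> i j. pincherle j (Q i * E i)) = (\<chi> i. E i *s row_matrix $ i)"
    by (simp add: vec_eq_iff row_matrix_def pincherle_mult column_def algebra_simps)
  hence det: "det (\<chi> i j. pincherle j (Q i * E i)) = (\<Prod>i\<in>UNIV. E i) * det row_matrix"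
    by (simp add: det_rows_mul)
  have E': "(\<Prod>i\<in>UNIV. E i) * (\<Prod>i\<in>UNIV. E' i ^ (n $ i + 1)) = (\<Prod>i\<in>UNIV. E' i ^ (n $ i))"
    by (simp add: prod.distrib[symmetric] mult.assoc[symmetric] EE')
  have "(\<Prod>i\<in>UNIV. E i) * det row_matrix * (\<Prod>i\<in>UNIV. K i ^ (n $ i + 1)) *
        (\<Prod>i\<in>UNIV. E' i ^ (n $ i + 1)) =
      det row_matrix * (\<Prod>i\<in>UNIV. K i ^ (n $ i + 1)) *
        ((\<Prod>i\<in>UNIV. E i) * (\<Prod>i\<in>UNIV. E' i ^ (n $ i + 1)))"
    by (simp only: mult_ac)
  thus ?thesis unfolding abel_def det E' by (rule arg_cong)
qed

text \<open>The transpose of \<open>row_matrix\<close> carries \<open>Q j\<close> in column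
  \<open>j\<close>; \<open>det_diagonal_conjugate\<close> trades this for \<open>Q i\<close> in row
  \<open>i\<close>.\<close>

lemma abel_eq_conjugate:
  "abel n = app (det (\<chi> i j. (if i = j then pincherle i (Q i) else 0) + A $ i $ j *\<^sub>R Q i) *
     (\<Prod>i\<in>UNIV. K i ^ (n $ i + 1)) * (\<Prod>i\<in>UNIV. E' i ^ (n $ i))) (\<Prod>i\<in>UNIV. X i ^ (n $ i))"
proof -
  have "det (\<chi> i j. (if i = j then pincherle i (Q i) else 0) + A $ i $ j *\<^sub>R Q i) =
      det (\<chi> i j. (if i = j then pincherle i (Q i) else 0) + A $ i $ j *\<^sub>R Q j)"
    using det_diagonal_conjugate[of "\<lambda>i. pincherle i (Q i)" Q "\<chi> i j. of_real (A $ i $ j)"]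
    by (simp add: scaleR_conv_of_real mult.commute)
  also have "(\<chi> i j. (if i = j then pincherle i (Q i) else 0) + A $ i $ j *\<^sub>R Q j) = transpose row_matrix"
    by (simp add: vec_eq_iff transpose_def row_matrix_def)
  finally show ?thesis by (simp only: abel_eq det_transpose)
qed

text \<open>For \<open>n $ i > 0\<close> this is the quotient of the shifted basic polynomial by its
  linear factor, by the transfer formula. For \<open>n $ i = 0\<close> it is 1 and enters
  \<open>abel_det\<close> with coefficient 0.\<close>

definition reduced_poly :: "nat ^ 'd \<Rightarrow> 'd \<Rightarrow> 'd rpoly" where
  "reduced_poly n i = shift (- node n) (app (K i ^ (n $ i)) (X i ^ (n $ i - 1)))"

lemma reduced_poly_mult:
  assumes "n $ i > 0"
  shows "(X i - of_real (node n $ i)) * reduced_poly n i =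
    psubst (p i (n $ i)) (X i - of_real (node n $ i))"
proof -
  obtain m where m: "n $ i = Suc m" using assms gr0_conv_Suc by blast
  have "psubst (p i (n $ i)) (X i) = X i * app (K i ^ (n $ i)) (X i ^ (n $ i - 1))"
    using basic_sequence_transfer[OF basic LK Q, of i "n $ i"] basic_sequence_transfer_X[OF LK Q, of i m]
    by (simp add: m)
  from arg_cong[OF this, of "shift (- node n)"]
  show ?thesis by (simp add: reduced_poly_def shift_psubst)
qed

lemma abel_det:
  "abel n = det (\<chi> i j. (if i = j then psubst (p i (n $ i)) (X i - of_real (node n $ i)) else 0) +
     of_real (real (n $ i) * A $ j $ i) * reduced_poly n i)"
proof -
  \<comment> \<open>The powers of \<open>K i\<close> are absorbed into row \<open>i\<close>, so that
    the transfer formula evaluates the diagonal part of each row.\<close>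
  have "det row_matrix * (\<Prod>i\<in>UNIV. K i ^ (n $ i + 1)) = det (\<chi> i. K i ^ (n $ i + 1) *s row_matrix $ i)"
    by (simp add: det_rows_mul)
  hence 1: "abel n = shift (- node n)
      (app (det (\<chi> i. K i ^ (n $ i + 1) *s row_matrix $ i)) (\<Prod>i\<in>UNIV. X i ^ (n $ i)))"
    unfolding abel_eq prod_E' by (simp add: mult.commute[of _ "shift_op _"])
  have Q_entry: "app (Q i * K i ^ (n $ i + 1)) (X i ^ (n $ i)) =
      real (n $ i) *\<^sub>R app (K i ^ (n $ i)) (X i ^ (n $ i - 1))" for i
  proof -
    have "Q i * K i ^ (n $ i + 1) = K i ^ (n $ i) * diff_op i"
      by (simp only: Suc_eq_plus1[symmetric] power_Suc mult.assoc[symmetric] QK) (rule mult.commute)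
    thus ?thesis by (simp only: app_simps diff_op.rep_eq partial_power_X app_arg_simps)
  qed
  have entry: "shift (- node n) (app (K i ^ (n $ i + 1) * row_matrix $ i $ j) (X i ^ (n $ i))) =
      (if i = j then psubst (p i (n $ i)) (X i - of_real (node n $ i)) else 0) +
     of_real (real (n $ i) * A $ j $ i) * reduced_poly n i" for i j
  proof -
    have "K i ^ (n $ i + 1) * row_matrix $ i $ j =
        (if i = j then pincherle i (Q i) * K i ^ Suc (n $ i) else 0) +
        A $ j $ i *\<^sub>R (Q i * K i ^ (n $ i + 1))"
      by (simp add: row_matrix_def algebra_simps)
    hence "app (K i ^ (n $ i + 1) * row_matrix $ i $ j) (X i ^ (n $ i)) =
        (if i = j then psubst (p i (n $ i)) (X i) else 0) +
        A $ j $ i *\<^sub>R app (Q i * K i ^ (n $ i + 1)) (X i ^ (n $ i))"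
      using basic_sequence_transfer[OF basic LK Q, of i "n $ i"] by (auto simp del: power_Suc)
    thus ?thesis
      unfolding Q_entry by (simp add: reduced_poly_def shift_psubst scaleR_conv_of_real algebra_simps)
  qed
  have "var_op i ((\<chi> i. K i ^ (n $ i + 1) *s row_matrix $ i) $ i $ j)" for i j
    by (cases "i = j") (simp_all add: row_matrix_def)
  from app_det[OF this var_poly_power] show ?thesis
    unfolding 1 by (simp only: shift_det vec_lambda_beta vector_smult_component entry)
qed

section \<open>Values at the origin\<close>

lemma abel_0: "abel 0 = 1"
proof -
  have "abel 0 = det (mat 1 :: 'd rpoly ^ 'd ^ 'd)"
    unfolding abel_det by (rule arg_cong[where f = det]) (simp add: mat_def vec_eq_iff)
  thus ?thesis by simp
qed

lemma ev_abel_0: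
  assumes "n \<noteq> 0"
  shows "ev (abel n) 0 = 0"
proof -
  \<comment> \<open>At the origin row \<open>i\<close> of \<open>abel_det\<close> is
    \<open>r i\<close> times row \<open>i\<close> of \<open>M\<close>: \<open>reduced_poly\<close>
    factors out if \<open>n $ i > 0\<close>, and otherwise the row is a unit vector.\<close>
  define M where "M = (\<chi> i j. (if i = j then if n $ i = 0 then 1 else - node n $ i else 0) +
     real (n $ i) * A $ j $ i)"
  define r where "r i = (if n $ i = 0 then 1 else ev (reduced_poly n i) 0)" for i
  \<comment> \<open>With these weights the diagonal contributes \<open>- node n $ j\<close> to
    column \<open>j\<close> in both cases, while the remaining entries sum to
    \<open>node n $ j\<close>.\<close>
  define v where "v = (\<chi> i. if n $ i = 0 then - node n $ i else 1)"
  have "ev (abel n) 0 = det (\<chi> i. r i *s M $ i)"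
    unfolding abel_det ev_det
  proof (rule arg_cong[where f = det], unfold vec_eq_iff, intro allI)
    fix i j
    have "n $ i > 0 \<Longrightarrow> poly (p i (n $ i)) (- node n $ i) = - node n $ i * ev (reduced_poly n i) 0"
      using arg_cong[OF reduced_poly_mult[of n i], of "\<lambda>f. ev f 0"] by (simp add: ev_psubst)
    thus "(\<chi> i j. ev ((\<chi> i j. (if i = j then psubst (p i (n $ i)) (X i - of_real (node n $ i)) else 0) +
          of_real (real (n $ i) * A $ j $ i) * reduced_poly n i) $ i $ j) 0) $ i $ j =
        (\<chi> i. r i *s M $ i) $ i $ j"
      by (auto simp: r_def M_def ev_psubst algebra_simps)
  qed
  also have "\<dots> = (\<Prod>i\<in>UNIV. r i) * det M"
    by (simp add: det_rows_mul)
  also have "det M = 0"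
  proof (rule det_eq_0_left_kernel)
    obtain i where "n $ i \<noteq> 0" using assms by (auto simp: vec_eq_iff)
    hence "v $ i \<noteq> 0 $ i" by (simp add: v_def)
    thus "v \<noteq> 0" by metis
    show "v v* M = 0"
    proof (unfold vec_eq_iff, intro allI)
      fix j
      have "(v v* M) $ j = (\<Sum>i\<in>UNIV. v $ i * M $ i $ j)"
        by (simp add: vector_matrix_mult_def mult.commute)
      also have "\<dots> = (\<Sum>i\<in>UNIV. (if i = j then - node n $ j else 0) + real (n $ i) * A $ j $ i)"
        by (rule sum.cong) (auto simp: v_def M_def)
      also have "\<dots> = 0"
        by (simp add: sum.distrib node_def matrix_vector_mult_def mult.commute)
      finally show "(v v* M) $ j = 0 $ j" by simp
    qed
  qed
  finally show ?thesis by simp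
qed

section \<open>The Abel polynomials solve the interpolation problem\<close>

lemma abel_in_poly_space: "abel n \<in> poly_space p n"
  unfolding poly_space_iff
proof
  fix i
  have "app (\<Prod>j\<in>UNIV. diff_op j ^ (if j = i then Suc (n $ i) else 0)) (\<Prod>j\<in>UNIV. X j ^ (n $ j)) = 0"
    unfolding partial_power_monomial by (auto intro!: exI[of _ i])
  moreover have "(\<Prod>j\<in>UNIV. diff_op j ^ (if j = i then Suc (n $ i) else 0)) = diff_op i ^ Suc (n $ i)"
    by (subst prod.cong[OF refl, of _ _ "\<lambda>j. if j = i then diff_op j ^ Suc (n $ i) else 1"]) auto
  ultimately have "app (diff_op i ^ Suc (n $ i)) (\<Prod>j\<in>UNIV. X j ^ (n $ j)) = 0" by simp
  \<comment> \<open>\<open>Q i\<close> contains \<open>diff_op i\<close>, so this power kills the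
    monomial, and operators commute.\<close>
  hence "app (R * Q i ^ Suc (n $ i)) (\<Prod>j\<in>UNIV. X j ^ (n $ j)) = 0" for R
    by (simp only: Q power_mult_distrib mult.commute[of "diff_op i ^ _"] app_simps app_arg_simps)
  thus "app (Q i ^ Suc (n $ i)) (abel n) = 0"
    unfolding abel_def by (simp only: app_simps(6)[symmetric] mult.commute[of "Q i ^ _"])
qed

text \<open>In each coordinate \<open>Q i * K i\<close> leaves \<open>diff_op i\<close> and
  \<open>E i\<close> cancels \<open>E' i\<close>; the determinant is untouched and the derivatives
  lower the monomial.\<close>

lemma app_abel:
  assumes "k \<le> n"
  shows "app ((\<Prod>i\<in>UNIV. Q i ^ (k $ i)) * (\<Prod>i\<in>UNIV. E i ^ (k $ i))) (abel n) =
    (\<Prod>i\<in>UNIV. fact (n $ i) / fact (n $ i - k $ i)) *\<^sub>R abel (n - k)"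
proof -
  let ?J = "det (\<chi> i j. pincherle j (Q i * E i))"
  have le: "k $ i \<le> n $ i" for i using assms by (simp add: less_eq_vec_def)
  have row: "Q i ^ (k $ i) * E i ^ (k $ i) * K i ^ (n $ i + 1) * E' i ^ (n $ i + 1) =
      K i ^ ((n - k) $ i + 1) * E' i ^ ((n - k) $ i + 1) * diff_op i ^ (k $ i)" for i
  proof -
    \<comment> \<open>The exponent is split so that exactly \<open>k $ i\<close> copies of the
      inverses are consumed.\<close>
    have n: "n $ i + 1 = k $ i + ((n - k) $ i + 1)" using le[of i] by simp
    have "Q i ^ (k $ i) * E i ^ (k $ i) * K i ^ (n $ i + 1) * E' i ^ (n $ i + 1) =
        (Q i * K i) ^ (k $ i) * (E i * E' i) ^ (k $ i) * K i ^ ((n - k) $ i + 1) * E' i ^ ((n - k) $ i + 1)"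
      unfolding n power_add[of _ "k $ i"] power_mult_distrib by (simp only: mult_ac)
    also have "\<dots> = diff_op i ^ (k $ i) * 1 * K i ^ ((n - k) $ i + 1) * E' i ^ ((n - k) $ i + 1)"
      by (simp only: QK EE' power_one)
    finally show ?thesis by (simp only: mult_1_left mult_ac)
  qed
  have "((\<Prod>i\<in>UNIV. Q i ^ (k $ i)) * (\<Prod>i\<in>UNIV. E i ^ (k $ i))) *
      (?J * (\<Prod>i\<in>UNIV. K i ^ (n $ i + 1)) * (\<Prod>i\<in>UNIV. E' i ^ (n $ i + 1))) =
      ?J * (\<Prod>i\<in>UNIV. Q i ^ (k $ i) * E i ^ (k $ i) * K i ^ (n $ i + 1) * E' i ^ (n $ i + 1))"
    by (simp only: prod.distrib mult_ac)
  also have "\<dots> = ?J * (\<Prod>i\<in>UNIV. K i ^ ((n - k) $ i + 1)) * (\<Prod>i\<in>UNIV. E' i ^ ((n - k) $ i + 1)) *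
      (\<Prod>i\<in>UNIV. diff_op i ^ (k $ i))"
    unfolding row by (simp only: prod.distrib mult_ac)
  finally have "app ((\<Prod>i\<in>UNIV. Q i ^ (k $ i)) * (\<Prod>i\<in>UNIV. E i ^ (k $ i))) (abel n) =
      app (?J * (\<Prod>i\<in>UNIV. K i ^ ((n - k) $ i + 1)) * (\<Prod>i\<in>UNIV. E' i ^ ((n - k) $ i + 1)))
        (app (\<Prod>i\<in>UNIV. diff_op i ^ (k $ i)) (\<Prod>i\<in>UNIV. X i ^ (n $ i)))"
    unfolding abel_def by (simp only: app_simps(6)[symmetric])
  also have "app (\<Prod>i\<in>UNIV. diff_op i ^ (k $ i)) (\<Prod>i\<in>UNIV. X i ^ (n $ i)) =
      (\<Prod>i\<in>UNIV. fact (n $ i) / fact (n $ i - k $ i)) *\<^sub>R (\<Prod>i\<in>UNIV. X i ^ ((n - k) $ i))"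
    unfolding partial_power_monomial
    by (simp add: le scaleR_conv_of_real prod.distrib of_real_prod)
  finally show ?thesis by (simp only: app_arg_simps abel_def)
qed

lemma abel_interpolates:
  assumes "k \<le> n"
  shows "ev (app (\<Prod>i\<in>UNIV. Q i ^ (k $ i)) (abel n)) (node k) =
    (if k = n then \<Prod>i\<in>UNIV. fact (n $ i) else 0)"
proof -
  have "ev (app (\<Prod>i\<in>UNIV. Q i ^ (k $ i)) (abel n)) (node k) =
      ev (app ((\<Prod>i\<in>UNIV. E i ^ (k $ i)) * (\<Prod>i\<in>UNIV. Q i ^ (k $ i))) (abel n)) 0"
    by (simp add: prod_E)
  also have "\<dots> = (\<Prod>i\<in>UNIV. fact (n $ i) / fact (n $ i - k $ i)) * ev (abel (n - k)) 0"
    by (simp only: app_abel[OF assms] mult.commute[of "\<Prod>i\<in>UNIV. E i ^ (k $ i)"] ev_simps)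
  also have "\<dots> = (if k = n then \<Prod>i\<in>UNIV. fact (n $ i) else 0)"
  proof (cases "k = n")
    case True
    thus ?thesis by (simp add: abel_0)
  next
    case False
    hence "n - k \<noteq> 0" using assms by (auto simp: vec_eq_iff less_eq_vec_def intro: antisym)
    thus ?thesis using False by (simp add: ev_abel_0)
  qed
  finally show ?thesis .
qed

lemma delta_goncarov_eq_abel: "delta_goncarov Q p node n = abel n"
  unfolding delta_goncarov_def
proof (rule the_equality)
  fix t
  assume t: "t \<in> poly_space p n \<and> (\<forall>k\<le>n. ev (app (\<Prod>i\<in>UNIV. Q i ^ (k $ i)) t) (node k) =
      (if k = n then \<Prod>i\<in>UNIV. fact (n $ i) else 0))"
  have "t - abel n = 0"
  proof (rule eq_0_if_interpolates_0)
    show "app (Q i ^ Suc (n $ i)) (t - abel n) = 0" for i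
      using t abel_in_poly_space[of n] unfolding poly_space_iff by (simp del: power_Suc)
    show "ev (app (\<Prod>i\<in>UNIV. Q i ^ (k $ i)) (t - abel n)) (node k) = 0" if "k \<le> n" for k
      using t that abel_interpolates[OF that] by simp
  qed
  thus "t = abel n" by simp
qed (use abel_in_poly_space abel_interpolates in blast)

text \<open>Multiplying row \<open>i\<close> of \<open>abel_det\<close> by its linear factor turns
  \<open>reduced_poly\<close> into the shifted basic polynomial, which then factors out of the whole
  row.\<close>

lemma abel_mult_denominator:
  "abel n * (\<Prod>i\<in>UNIV. X i - of_real (node n $ i)) =
     det ((\<chi> i j. if i = j then X i - of_real (node n $ i) else 0) +
       (\<chi> i j. of_real (node (axis i (n $ i)) $ j))) *
     (\<Prod>i\<in>UNIV. psubst (p i (n $ i)) (X i - of_real (node n $ i)))"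
proof -
  let ?Y = "\<lambda>i. X i - of_real (node n $ i)"
  let ?q = "\<lambda>i. psubst (p i (n $ i)) (?Y i)"
  define N where "N = (\<chi> i j. (if i = j then ?q i else 0) + of_real (real (n $ i) * A $ j $ i) * reduced_poly n i)"
  define M where "M = (\<chi> i j. if i = j then ?Y i else 0) + (\<chi> i j. of_real (node (axis i (n $ i)) $ j))"
  have "?Y i * N $ i $ j = ?q i * M $ i $ j" for i j
  proof -
    have "node (axis i (n $ i)) $ j = (\<Sum>l\<in>UNIV. if l = i then real (n $ i) * A $ j $ i else 0)"
      unfolding node_def matrix_vector_mult_def vec_lambda_beta
      by (rule sum.cong) (auto simp: axis_def)
    hence node: "node (axis i (n $ i)) $ j = real (n $ i) * A $ j $ i" by simp
    \<comment> \<open>If \<open>n $ i = 0\<close>, both sides vanish through the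
      coefficient.\<close>
    have "of_real (real (n $ i) * A $ j $ i) * (?Y i * reduced_poly n i) = of_real (real (n $ i) * A $ j $ i) * ?q i"
      using reduced_poly_mult[of n i] by (cases "n $ i = 0") simp_all
    thus ?thesis
      by (simp only: N_def M_def node vector_add_component vec_lambda_beta) (simp add: algebra_simps)
  qed
  hence "(\<chi> i. ?Y i *s N $ i) = (\<chi> i. ?q i *s M $ i)"
    by (auto simp only: vec_eq_iff vec_lambda_beta vector_smult_component)
  hence "det (\<chi> i. ?Y i *s N $ i) = det (\<chi> i. ?q i *s M $ i)" by simp
  hence "(\<Prod>i\<in>UNIV. ?Y i) * det N = (\<Prod>i\<in>UNIV. ?q i) * det M"
    by (simp only: det_rows_mul vec_lambda_eta)
  thus ?thesis unfolding abel_det N_def M_def by (simp only: mult.commute)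
qed

end

theorem theorem7:
  fixes c :: "'d::finite \<Rightarrow> nat \<Rightarrow> real"
    and p :: "'d \<Rightarrow> nat \<Rightarrow> real poly"
    and A :: "real ^ 'd ^ 'd"
    and n :: "nat ^ 'd"
    and L Q S :: "'d \<Rightarrow> 'd sio"
    and z :: "nat ^ 'd \<Rightarrow> real ^ 'd"
    and t :: "nat ^ 'd \<Rightarrow> 'd rpoly"
    and B C :: "'d rpoly ^ 'd ^ 'd"
    and F G :: "'d sio ^ 'd ^ 'd"
  defines "L \<equiv> \<lambda>i. series_op i (c i)"
    and "Q \<equiv> \<lambda>i. diff_op i * L i"
    and "z \<equiv> \<lambda>k. A *v (\<chi> i. real (k $ i))"
    and "t \<equiv> delta_goncarov Q p z"
    and "B \<equiv> \<chi> i j. if i = j then X i - of_real (z n $ i) else 0"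
    and "C \<equiv> \<chi> i j. of_real (z (axis i (n $ i)) $ j)"
    and "F \<equiv> \<chi> i j. if i = j then pincherle i (Q i) else 0"
    and "G \<equiv> \<chi> i j. A $ i $ j *\<^sub>R Q i"
    and "S \<equiv> \<lambda>i. Q i * shift_op (column i A)"
  assumes "\<And>i. c i 0 \<noteq> 0"
    and "\<And>i. basic_sequence i (Q i) (p i)"
  shows "Fraction_Field.Fract (t n) 1 =
           Fraction_Field.Fract (det (B + C)) 1 *
           (\<Prod>i\<in>UNIV. Fraction_Field.Fract (psubst (p i (n $ i)) (X i - of_real (z n $ i)))
                                         (X i - of_real (z n $ i))) \<and>
         t n =
           app (det (\<chi> i j. pincherle j (S i)) *
                (\<Prod>i\<in>UNIV. unit_inv (L i) ^ (n $ i + 1)) *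
                (\<Prod>i\<in>UNIV. unit_inv (shift_op (column i A)) ^ (n $ i + 1)))
             (\<Prod>i\<in>UNIV. X i ^ (n $ i)) \<and>
         t n =
           app (det (F + G) *
                (\<Prod>i\<in>UNIV. unit_inv (L i) ^ (n $ i + 1)) *
                (\<Prod>i\<in>UNIV. unit_inv (shift_op (column i A)) ^ (n $ i)))
             (\<Prod>i\<in>UNIV. X i ^ (n $ i))"
proof -
  define K where "K i = unit_inv (L i)" for i
  have "L i * K i = 1" for i
  proof -
    obtain R where "L i * R = 1"
      using series_op_unit[of "c i"] assms(10) unfolding L_def by blast
    thus ?thesis by (simp add: K_def unit_inv_eqI)
  qed
  then interpret delta_system L K Q p A
    using assms(11) by unfold_locales (simp_all add: Q_def L_def)
  have z: "z = node" by (simp add: fun_eq_iff z_def node_def)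
  have t: "t n = abel n" by (simp add: t_def z delta_goncarov_eq_abel)
  have nz: "X i - of_real (z n $ i) \<noteq> 0" for i
  proof
    assume "X i - of_real (z n $ i) = 0"
    \<comment> \<open>Evaluated one unit beyond the node coordinate, the linear factor has value
      1.\<close>
    from arg_cong[OF this, of "\<lambda>f. ev f (\<chi> j. z n $ i + 1)"] show False by simp
  qed
  have prod_Fract: "(\<Prod>i\<in>I. Fraction_Field.Fract (f i) (g i)) =
      Fraction_Field.Fract (\<Prod>i\<in>I. f i) (\<Prod>i\<in>I. g i)"
    if "finite I" for I and f g :: "'d \<Rightarrow> 'd rpoly"
    using that by induction (simp_all add: One_fract_def)
  have "abel n * (\<Prod>i\<in>UNIV. X i - of_real (z n $ i)) =
      det (B + C) * (\<Prod>i\<in>UNIV. psubst (p i (n $ i)) (X i - of_real (z n $ i)))"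
    unfolding B_def C_def z by (rule abel_mult_denominator)
  hence "Fraction_Field.Fract (t n) 1 =
      Fraction_Field.Fract (det (B + C)) 1 *
      (\<Prod>i\<in>UNIV. Fraction_Field.Fract (psubst (p i (n $ i)) (X i - of_real (z n $ i)))
                                    (X i - of_real (z n $ i)))"
    using nz by (simp add: prod_Fract eq_fract t)
  moreover have "F + G = (\<chi> i j. (if i = j then pincherle i (Q i) else 0) + A $ i $ j *\<^sub>R Q i)"
    by (simp add: F_def G_def vec_eq_iff)
  ultimately show ?thesis
    using abel_eq_conjugate[of n]
    by (simp only: t S_def unit_inv_shift_op abel_def K_def simp_thms)
qed

end
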